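(* There exist an absolute constant $c>0$ and, for every sufficiently large $n$, a pair of length-$n$ strings of probabilities $S=p_1,\ldots,p_n$ and $S'=p'_1,\ldots,p'_n$ (all $p_i,p'_i\in[0,1]$) such that $\max_i|p_i-p'_i|$ is bounded below by a positive absolute constant, $\sum_i|p_i-p'_i|=\Theta(\sqrt n)$, and for every deletion probability $\delta\ge c/\sqrt n$ (in particular every constant $\delta\in(0,1)$), the total variation distance between the distribution of a single trace drawn from $S$ and that of a single trace drawn from $S'$ is $e^{-\Omega(\sqrt n)}$ (with the implied constants independent of $n$ and $\delta$).
   Context: Generalized trace reconstruction with deletion probability $\delta\in(0,1)$: given a string of probabilities $S=p_1,\ldots,p_n$, a trace is generated by (1) sampling a binary string $T=t_1,\ldots,t_n$ with the $t_i$ independent and $\Pr[t_i=1]=p_i$, and then (2) deleting each bit of $T$ independently with probability $\delta$ and returning the concatenation of the surviving bits (a binary string of length $\le n$). *)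

theory Defs
  imports "HOL-Probability.Probability"
begin

fun sample_bits :: "real list \<Rightarrow> bool list pmf" where
  "sample_bits [] = return_pmf []"
| "sample_bits (p # ps) =
     bind_pmf (bernoulli_pmf p) (\<lambda>t. map_pmf (\<lambda>r. t # r) (sample_bits ps))"

fun deletion_channel :: "real \<Rightarrow> bool list \<Rightarrow> bool list pmf" where
  "deletion_channel d [] = return_pmf []"
| "deletion_channel d (t # ts) =
     bind_pmf (bernoulli_pmf d)
       (\<lambda>del. map_pmf (\<lambda>r. if del then r else t # r) (deletion_channel d ts))"

definition trace_dist :: "real list \<Rightarrow> real \<Rightarrow> bool list pmf" where
  "trace_dist S d = bind_pmf (sample_bits S) (deletion_channel d)"

definition tv_dist :: "'a pmf \<Rightarrow> 'a pmf \<Rightarrow> real" where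
  "tv_dist P Q = (SUP A. \<bar>measure_pmf.prob P A - measure_pmf.prob Q A\<bar>)"

end

theory Submission
  imports Defs "HOL-Computational_Algebra.Polynomial"
begin

text \<open>
  Take \<open>h\<close> about \<open>sqrt n / 2\<close> and weights \<open>r i = \<rho> * exp (- ((i - h\<^sup>2) / h)\<^sup>2)\<close> on a window of length
  \<open>2 * h\<^sup>2\<close>, surrounded by at least \<open>h\<^sup>2\<close> zeros on each side. The first string has odds \<open>r i\<close> at the odd
  positions of the window and \<open>0\<close> elsewhere, the second one at the even positions. Up to normalization,
  a set \<open>X\<close> of ones then has weight \<open>\<Prod>i\<in>X. r i\<close> provided that its elements have the right parity, so the
  difference of the two laws is a signed measure on sets that alternates in sign under translation.

  Write \<open>A\<close> and \<open>B\<close> for the (commuting) operators that put one zero, subject to deletion with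
  probability \<open>d\<close>, before or after a word, and \<open>z\<close>, \<open>w\<close> for those that put an undeleted zero there. From
  \<open>A = d + (1 - d) * z\<close> and \<open>B = d + (1 - d) * w\<close> one gets
  \<open>A * B = (1 - d)\<^sup>2 * z * w - d\<^sup>2 + d * (A + B)\<close>. Expanding \<open>(A * B)^q\<close> accordingly, the terms with fewer
  than \<open>2 * h\<close> factors \<open>A + B\<close> are exponentially small in \<open>q * d\<close>, while \<open>(A + B)^(2 * h)\<close> acts on the
  signed measure as a finite difference of order \<open>2 * h\<close> of the smooth product weight, which is
  exponentially small in \<open>h\<close> because the alternating binomial sum kills polynomials of degree below
  \<open>2 * h\<close>.

  This settles \<open>d = 8 / h\<close>. A larger deletion probability is obtained by composing two channels.
\<close>

subsection \<open>Sampling and deletion\<close>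

abbreviation expect :: "'a pmf \<Rightarrow> ('a \<Rightarrow> real) \<Rightarrow> real" where
  "expect \<equiv> measure_pmf.expectation"

lemma expect_bind_finite:
  assumes "finite (set_pmf p)" "\<And>x. x \<in> set_pmf p \<Longrightarrow> finite (set_pmf (f x))"
  shows "expect (bind_pmf p f) g = expect p (\<lambda>x. expect (f x) g)"
proof -
  have "expect (bind_pmf p f) g = (\<Sum>a\<in>set_pmf p. pmf p a *\<^sub>R expect (f a) g)"
    using assms by (intro pmf_expectation_bind) auto
  also have "\<dots> = expect p (\<lambda>x. expect (f x) g)"
    using assms(1) by (subst integral_measure_pmf[of "set_pmf p"]) auto
  finally show ?thesis .
qed

lemma expect_abs_le:
  assumes "\<And>x. \<bar>g x\<bar> \<le> 1"
  shows "\<bar>expect p g\<bar> \<le> 1"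
proof -
  have i: "integrable (measure_pmf p) g"
    by (rule measure_pmf.integrable_const_bound[where B=1]) (use assms in auto)
  have "\<bar>expect p g\<bar> \<le> expect p (\<lambda>x. \<bar>g x\<bar>)"
    by simp
  also have "\<dots> \<le> expect p (\<lambda>_. 1)"
    using assms i by (intro integral_mono) auto
  finally show ?thesis by simp
qed

lemma finite_set_sample_bits: "finite (set_pmf (sample_bits ps))"
  by (induction ps) auto

lemma finite_set_deletion_channel: "finite (set_pmf (deletion_channel d ts))"
  by (induction ts) auto

lemma sample_bits_append:
  "sample_bits (ps @ qs) = bind_pmf (sample_bits ps) (\<lambda>a. map_pmf (\<lambda>b. a @ b) (sample_bits qs))"
  by (induction ps) (simp_all add: bind_return_pmf bind_assoc_pmf map_pmf_def bind_return_pmf')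

lemma deletion_channel_append:
  "deletion_channel d (ts @ us) =
     bind_pmf (deletion_channel d ts) (\<lambda>a. map_pmf (\<lambda>b. a @ b) (deletion_channel d us))"
proof (induction ts)
  case (Cons t ts)
  show ?case
    by (simp add: Cons bind_assoc_pmf map_pmf_def bind_return_pmf if_distrib[of "\<lambda>x. x @ _"] cong: if_cong)
qed (simp add: bind_return_pmf map_pmf_def bind_return_pmf')

lemma bernoulli_pmf_0: "bernoulli_pmf 0 = return_pmf False"
proof (rule pmf_eqI)
  show "pmf (bernoulli_pmf 0) i = pmf (return_pmf False) i" for i
    by (cases i) auto
qed

lemma sample_bits_replicate_0: "sample_bits (replicate k 0) = return_pmf (replicate k False)"
  by (induction k) (simp_all add: bernoulli_pmf_0 bind_return_pmf)

section \<open>Composition of deletion channels\<close>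

lemma bernoulli_deletion_compose:
  assumes "0 \<le> d" "d \<le> 1" "0 \<le> e" "e \<le> 1"
  shows "bind_pmf (bernoulli_pmf d) (\<lambda>x. if x then P else bind_pmf (bernoulli_pmf e) (\<lambda>y. if y then P else Q))
       = bind_pmf (bernoulli_pmf (d + (1 - d) * e)) (\<lambda>x. if x then P else Q)"
proof (rule pmf_eqI)
  fix i
  define w where "w = d + (1 - d) * e"
  have w: "0 \<le> w" "w \<le> 1"
    using mult_left_mono[of e 1 "1 - d"] assms by (simp_all add: w_def)
  have "pmf (bind_pmf (bernoulli_pmf d) (\<lambda>x. if x then P else bind_pmf (bernoulli_pmf e) (\<lambda>y. if y then P else Q))) i
      = pmf P i * d + (pmf P i * e + pmf Q i * (1 - e)) * (1 - d)"
    using assms by (simp add: pmf_bind)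
  also have "\<dots> = pmf P i * w + pmf Q i * (1 - w)"
    by (simp add: w_def algebra_simps)
  also have "\<dots> = pmf (bind_pmf (bernoulli_pmf w) (\<lambda>x. if x then P else Q)) i"
    using w by (simp add: pmf_bind)
  finally show "pmf (bind_pmf (bernoulli_pmf d) (\<lambda>x. if x then P else bind_pmf (bernoulli_pmf e) (\<lambda>y. if y then P else Q))) i
       = pmf (bind_pmf (bernoulli_pmf (d + (1 - d) * e)) (\<lambda>x. if x then P else Q)) i"
    by (simp add: w_def)
qed

text \<open>A bit survives both passes with probability \<open>(1 - d) * (1 - e)\<close>,
  independently of the others. This transfers a bound at one deletion probability to every larger
  one.\<close>

lemma deletion_channel_compose:
  assumes "0 \<le> d" "d \<le> 1" "0 \<le> e" "e \<le> 1"
  shows "bind_pmf (deletion_channel d ts) (deletion_channel e) = deletion_channel (d + (1 - d) * e) ts"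
proof (induction ts)
  case (Cons t ts)
  let ?P = "deletion_channel (d + (1 - d) * e) ts"
  let ?D = "deletion_channel d ts"
  have "bind_pmf (deletion_channel d (t # ts)) (deletion_channel e)
      = bind_pmf (bernoulli_pmf d) (\<lambda>x. bind_pmf ?D (\<lambda>r. deletion_channel e (if x then r else t # r)))"
    by (simp add: bind_assoc_pmf map_pmf_def bind_return_pmf)
  also have "\<dots> = bind_pmf (bernoulli_pmf d) (\<lambda>x. if x then ?P
       else bind_pmf (bernoulli_pmf e) (\<lambda>y. if y then ?P else map_pmf ((#) t) ?P))"
  proof (rule bind_pmf_cong[OF refl])
    fix x
    \<comment> \<open>The second coin for \<open>t\<close> is independent of the tail, so it can be
      drawn first; the induction hypothesis then merges the two passes over the tail.\<close>
    have "bind_pmf ?D (\<lambda>r. deletion_channel e (t # r)) =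
        bind_pmf (bernoulli_pmf e) (\<lambda>y. bind_pmf ?D (\<lambda>r. map_pmf (\<lambda>s. if y then s else t # s) (deletion_channel e r)))"
      by (simp, subst bind_commute_pmf) simp
    also have "\<dots> = bind_pmf (bernoulli_pmf e) (\<lambda>y. map_pmf (\<lambda>s. if y then s else t # s) ?P)"
      by (simp add: map_bind_pmf[symmetric] Cons)
    also have "\<dots> = bind_pmf (bernoulli_pmf e) (\<lambda>y. if y then ?P else map_pmf ((#) t) ?P)"
      by (intro bind_pmf_cong) auto
    finally show "bind_pmf ?D (\<lambda>r. deletion_channel e (if x then r else t # r)) =
       (if x then ?P else bind_pmf (bernoulli_pmf e) (\<lambda>y. if y then ?P else map_pmf ((#) t) ?P))"
      by (simp add: Cons)
  qed
  also have "\<dots> = bind_pmf (bernoulli_pmf (d + (1 - d) * e)) (\<lambda>x. if x then ?P else map_pmf ((#) t) ?P)"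
    by (rule bernoulli_deletion_compose[OF assms])
  also have "\<dots> = deletion_channel (d + (1 - d) * e) (t # ts)"
    by (simp, intro bind_pmf_cong) auto
  finally show ?case .
qed (simp add: bind_return_pmf)

text \<open>Words are encoded by their sets of ones, so that moving a padding zero from one end to
  the other becomes a translation of the set.\<close>

definition indicator_word :: "nat \<Rightarrow> nat set \<Rightarrow> bool list" where
  "indicator_word u X = map (\<lambda>i. i \<in> X) [0..<u]"

lemma expect_sample_bits:
  assumes "\<And>i. i < u \<Longrightarrow> 0 \<le> p i \<and> p i \<le> 1"
  shows "expect (sample_bits (map p [0..<u])) f =
    (\<Sum>X\<in>Pow {..<u}. (\<Prod>i\<in>X. p i) * (\<Prod>i\<in>{..<u} - X. 1 - p i) * f (indicator_word u X))"
  using assms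
proof (induction u arbitrary: f)
  case 0
  then show ?case by (simp add: indicator_word_def)
next
  case (Suc u)
  let ?w = "\<lambda>A X. (\<Prod>i\<in>X. p i) * (\<Prod>i\<in>A - X. 1 - p i)"
  have p: "0 \<le> p u" "p u \<le> 1" using Suc.prems[of u] by auto
  have "expect (sample_bits (map p [0..<Suc u])) f =
      expect (sample_bits (map p [0..<u])) (\<lambda>r. f (r @ [True]) * p u + f (r @ [False]) * (1 - p u))"
    by (simp add: sample_bits_append expect_bind_finite finite_set_sample_bits map_pmf_def
          bind_assoc_pmf bind_return_pmf p)
  also have "\<dots> = (\<Sum>X\<in>Pow {..<u}. ?w {..<u} X *
      (f (indicator_word u X @ [True]) * p u + f (indicator_word u X @ [False]) * (1 - p u)))"
    using Suc by (subst Suc.IH) auto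
  \<comment> \<open>A subset of \<open>{..<Suc u}\<close> either avoids \<open>u\<close> or is
    \<open>insert u X\<close> with \<open>X\<close> below \<open>u\<close>, matching a last bit
    \<open>False\<close> or \<open>True\<close>.\<close>
  also have "\<dots> = (\<Sum>X\<in>Pow {..<u}. ?w {..<Suc u} X * f (indicator_word (Suc u) X))
      + (\<Sum>X\<in>Pow {..<u}. ?w {..<Suc u} (insert u X) * f (indicator_word (Suc u) (insert u X)))"
    unfolding sum.distrib[symmetric]
  proof (rule sum.cong[OF refl])
    fix X assume X: "X \<in> Pow {..<u}"
    then have fin: "finite X" and u: "u \<notin> X" by (auto intro: finite_subset)
    have 1: "{..<Suc u} - X = insert u ({..<u} - X)" "{..<Suc u} - insert u X = {..<u} - X"
      using u by auto
    have 2: "indicator_word (Suc u) X = indicator_word u X @ [False]"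
      "indicator_word (Suc u) (insert u X) = indicator_word u X @ [True]"
      using u by (auto simp: indicator_word_def)
    show "?w {..<u} X * (f (indicator_word u X @ [True]) * p u + f (indicator_word u X @ [False]) * (1 - p u))
      = ?w {..<Suc u} X * f (indicator_word (Suc u) X)
        + ?w {..<Suc u} (insert u X) * f (indicator_word (Suc u) (insert u X))"
      unfolding 1 2 using fin u by (simp add: algebra_simps)
  qed
  also have "(\<Sum>X\<in>Pow {..<u}. ?w {..<Suc u} (insert u X) * f (indicator_word (Suc u) (insert u X)))
     = (\<Sum>X\<in>insert u ` Pow {..<u}. ?w {..<Suc u} X * f (indicator_word (Suc u) X))"
    by (subst sum.reindex) (auto simp: inj_on_def)
  also have "(\<Sum>X\<in>Pow {..<u}. ?w {..<Suc u} X * f (indicator_word (Suc u) X)) + \<dots>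
     = (\<Sum>X\<in>Pow {..<Suc u}. ?w {..<Suc u} X * f (indicator_word (Suc u) X))"
    unfolding lessThan_Suc Pow_insert by (subst sum.union_disjoint) auto
  finally show ?case .
qed

text \<open>With \<open>p = r / (1 + r)\<close> a zero contributes \<open>1 / (1 + r)\<close> and a
  one \<open>r / (1 + r)\<close>. Clearing the common denominator leaves a weight that depends on
  the ones alone, hence behaves well under translation.\<close>

lemma expect_sample_bits_odds:
  fixes r :: "nat \<Rightarrow> real"
  assumes "\<And>i. 0 \<le> r i"
  shows "(\<Prod>i<u. 1 + r i) * expect (sample_bits (map (\<lambda>i. r i / (1 + r i)) [0..<u])) f =
    (\<Sum>X\<in>Pow {..<u}. (\<Prod>i\<in>X. r i) * f (indicator_word u X))"
proof -
  have pos: "1 + r i > 0" for i using assms[of i] by linarith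
  have "expect (sample_bits (map (\<lambda>i. r i / (1 + r i)) [0..<u])) f =
    (\<Sum>X\<in>Pow {..<u}. (\<Prod>i\<in>X. r i / (1 + r i)) * (\<Prod>i\<in>{..<u} - X. 1 - r i / (1 + r i)) * f (indicator_word u X))"
    using assms pos by (intro expect_sample_bits) auto
  moreover have "(\<Prod>i<u. 1 + r i) * ((\<Prod>i\<in>X. r i / (1 + r i)) * (\<Prod>i\<in>{..<u} - X. 1 - r i / (1 + r i))) = (\<Prod>i\<in>X. r i)"
    if "X \<in> Pow {..<u}" for X
  proof -
    have fX: "finite X" using that by (auto intro: finite_subset)
    have 1: "(\<Prod>i<u. 1 + r i) = (\<Prod>i\<in>{..<u} - X. 1 + r i) * (\<Prod>i\<in>X. 1 + r i)"
      using that by (intro prod.subset_diff) auto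
    have 2: "(\<Prod>i\<in>{..<u} - X. 1 + r i) * (\<Prod>i\<in>{..<u} - X. 1 - r i / (1 + r i)) = 1"
      unfolding prod.distrib[symmetric] using pos
      by (intro prod.neutral) (auto simp: field_simps less_imp_neq[symmetric])
    have 3: "(\<Prod>i\<in>X. 1 + r i) * (\<Prod>i\<in>X. r i / (1 + r i)) = (\<Prod>i\<in>X. r i)"
      unfolding prod.distrib[symmetric] using pos
      by (intro prod.cong) (auto simp: field_simps less_imp_neq[symmetric])
    show ?thesis unfolding 1 using 2 3 by (simp add: algebra_simps)
  qed
  ultimately show ?thesis
    by (simp add: sum_distrib_left mult.assoc[symmetric])
qed

subsection \<open>Alternating binomial sums\<close>

text \<open>The leading coefficients of \<open>p\<close> and its translate cancel. The alternative
  \<open>= 0\<close> covers \<open>m = 0\<close>, where no degree is smaller.\<close>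

lemma degree_difference_less:
  fixes p :: "real poly"
  assumes "degree p < Suc m"
  shows "degree (pcompose p [:1, 1:] - p) < m \<or> pcompose p [:1, 1:] - p = 0"
proof (cases "degree p = 0")
  case True
  then obtain c where "p = [:c:]" by (metis degree_0_id)
  then show ?thesis by simp
next
  case False
  have d: "degree (pcompose p [:1, 1:]) = degree p" by (simp add: degree_pcompose)
  have "lead_coeff (pcompose p [:1, 1:]) = lead_coeff p"
    by (subst lead_coeff_comp) auto
  then have "coeff (pcompose p [:1, 1:] - p) (degree p) = 0" using d by simp
  moreover have "degree (pcompose p [:1, 1:] - p) \<le> degree p"
    using d by (intro degree_diff_le) auto
  ultimately have "degree (pcompose p [:1, 1:] - p) < degree p \<or> pcompose p [:1, 1:] - p = 0"
    by (metis False eq_zero_or_degree_less)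
  then show ?thesis using assms by auto
qed

text \<open>Pascal's rule, for arbitrary \<open>g\<close> because it serves both the alternating
  sums and \<open>pair_sum\<close>.\<close>

lemma binomial_sum_Suc:
  fixes g :: "nat \<Rightarrow> real"
  shows "(\<Sum>s\<le>Suc m. real (Suc m choose s) * g s)
    = (\<Sum>s\<le>m. real (m choose s) * g (Suc s)) + (\<Sum>s\<le>m. real (m choose s) * g s)"
proof -
  have "(\<Sum>s\<le>Suc m. real (Suc m choose s) * g s)
      = g 0 + (\<Sum>s\<le>m. real (Suc m choose Suc s) * g (Suc s))"
    by (subst sum.atMost_Suc_shift) simp
  also have "\<dots> = (\<Sum>s\<le>m. real (m choose s) * g (Suc s)) + (g 0 + (\<Sum>s\<le>m. real (m choose Suc s) * g (Suc s)))"
    by (simp add: sum.distrib algebra_simps)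
  also have "g 0 + (\<Sum>s\<le>m. real (m choose Suc s) * g (Suc s)) = (\<Sum>s\<le>Suc m. real (m choose s) * g s)"
    by (subst sum.atMost_Suc_shift) simp
  finally show ?thesis by simp
qed

text \<open>Up to sign the sum is the \<open>m\<close>-th forward difference of \<open>p\<close> at
  0, and each difference lowers the degree.\<close>

lemma alternating_binomial_poly:
  fixes p :: "real poly"
  assumes "degree p < m"
  shows "(\<Sum>s\<le>m. real (m choose s) * ((-1) ^ s * poly p (real s))) = 0"
  using assms
proof (induction m arbitrary: p)
  case (Suc m)
  let ?q = "pcompose p [:1, 1:] - p"
  have "(\<Sum>s\<le>Suc m. real (Suc m choose s) * ((-1) ^ s * poly p (real s)))
     = - (\<Sum>s\<le>m. real (m choose s) * ((-1) ^ s * poly ?q (real s)))"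
    unfolding binomial_sum_Suc
    by (simp add: poly_pcompose sum_negf[symmetric] sum.distrib[symmetric] algebra_simps)
  also have "\<dots> = 0"
    using degree_difference_less[OF Suc.prems] Suc.IH[of ?q] by auto
  finally show ?case .
qed simp

text \<open>Trading the factorial for a factor \<open>exp (\<mu> * \<bar>v\<bar>)\<close> makes the
  remainder geometric in \<open>L\<close>. Once \<open>\<bar>v\<bar>\<close> is bounded by a sum
  over points, the exponential splits into one factor per point.\<close>

lemma exp_taylor_remainder:
  fixes v \<mu> :: real
  assumes "\<mu> > 0"
  shows "\<bar>exp v - (\<Sum>l<L. v ^ l / fact l)\<bar> \<le> (1 / \<mu>) ^ L * exp ((1 + \<mu>) * \<bar>v\<bar>)"
proof -
  obtain t where t: "\<bar>t\<bar> \<le> \<bar>v\<bar>" "exp v = (\<Sum>l<L. v ^ l / fact l) + (exp t / fact L) * v ^ L"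
    using Maclaurin_exp_le[of v L] by auto
  \<comment> \<open>A single term of the exponential series is at most the whole series.\<close>
  have "(\<mu> * \<bar>v\<bar>) ^ L / fact L \<le> exp (\<mu> * \<bar>v\<bar>)"
  proof -
    have "(\<Sum>l\<in>{L}. (\<mu> * \<bar>v\<bar>) ^ l /\<^sub>R fact l) \<le> exp (\<mu> * \<bar>v\<bar>)"
      unfolding exp_def using assms summable_exp_generic[of "\<mu> * \<bar>v\<bar>"]
      by (intro sum_le_suminf) auto
    then show ?thesis by (simp add: field_simps)
  qed
  then have a: "\<bar>v\<bar> ^ L / fact L \<le> (1 / \<mu>) ^ L * exp (\<mu> * \<bar>v\<bar>)"
    using assms by (simp add: power_mult_distrib field_simps)
  have "\<bar>exp v - (\<Sum>l<L. v ^ l / fact l)\<bar> = exp t * (\<bar>v\<bar> ^ L / fact L)"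
    using t(2) by (simp add: abs_mult power_abs)
  also have "\<dots> \<le> exp \<bar>v\<bar> * ((1 / \<mu>) ^ L * exp (\<mu> * \<bar>v\<bar>))"
    using t(1) a by (intro mult_mono) auto
  finally show ?thesis by (simp add: exp_add algebra_simps)
qed

lemma degree_taylor_quadratic:
  fixes a b :: real
  assumes "L > 0"
  shows "degree (\<Sum>l<L. smult (1 / fact l) ([:0, a, b:] ^ l)) < 2 * L"
proof (rule degree_sum_less)
  fix l assume "l \<in> {..<L}"
  have "degree ([:0, a, b:] ^ l) \<le> degree [:0, a, b:] * l" by (rule degree_power_le)
  also have "\<dots> \<le> 2 * l" by (intro mult_right_mono) auto
  finally show "degree (smult (1 / fact l) ([:0, a, b:] ^ l)) < 2 * L"
    using \<open>l \<in> {..<L}\<close> by auto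
qed (use assms in auto)

text \<open>The Taylor polynomial of order \<open>L\<close> of the exponential, evaluated at a quadratic polynomial,
  has degree below \<open>2 * L\<close>, so the alternating binomial sum only sees the Taylor remainder.\<close>

lemma alternating_binomial_exp_quadratic:
  fixes a b \<mu> V :: real
  assumes "L > 0" "\<mu> > 0" and V: "\<And>s. s \<le> 2 * L \<Longrightarrow> \<bar>a * real s + b * (real s)\<^sup>2\<bar> \<le> V"
  shows "\<bar>\<Sum>s\<le>2 * L. real (2 * L choose s) * ((-1) ^ s * exp (a * real s + b * (real s)\<^sup>2))\<bar>
     \<le> 2 ^ (2 * L) * ((1 / \<mu>) ^ L * exp ((1 + \<mu>) * V))"
proof -
  define v where "v = (\<lambda>s. a * real s + b * (real s)\<^sup>2)"
  define p where "p = (\<Sum>l<L. smult (1 / fact l) ([:0, a, b:] ^ l))"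
  have p: "poly p (real s) = (\<Sum>l<L. v s ^ l / fact l)" for s
    by (simp add: p_def v_def poly_sum poly_power algebra_simps power2_eq_square)
  have "degree p < 2 * L"
    unfolding p_def using assms(1) by (rule degree_taylor_quadratic)
  from alternating_binomial_poly[OF this]
  have "(\<Sum>s\<le>2 * L. real (2 * L choose s) * ((-1) ^ s * exp (v s)))
      = (\<Sum>s\<le>2 * L. real (2 * L choose s) * ((-1) ^ s * (exp (v s) - (\<Sum>l<L. v s ^ l / fact l))))"
    unfolding p by (simp add: sum_subtractf right_diff_distrib)
  also have "\<bar>\<dots>\<bar> \<le> (\<Sum>s\<le>2 * L. real (2 * L choose s) * ((1 / \<mu>) ^ L * exp ((1 + \<mu>) * V)))"
  proof (rule order_trans[OF sum_abs], rule sum_mono)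
    fix s assume s: "s \<in> {..2 * L}"
    have "\<bar>exp (v s) - (\<Sum>l<L. v s ^ l / fact l)\<bar> \<le> (1 / \<mu>) ^ L * exp ((1 + \<mu>) * \<bar>v s\<bar>)"
      by (rule exp_taylor_remainder) fact
    also have "\<dots> \<le> (1 / \<mu>) ^ L * exp ((1 + \<mu>) * V)"
      using V[of s] s assms(2) by (intro mult_left_mono) (auto simp: v_def)
    finally show "\<bar>real (2 * L choose s) * ((-1) ^ s * (exp (v s) - (\<Sum>l<L. v s ^ l / fact l)))\<bar>
        \<le> real (2 * L choose s) * ((1 / \<mu>) ^ L * exp ((1 + \<mu>) * V))"
      by (simp add: abs_mult mult_left_mono)
  qed
  also have "\<dots> = 2 ^ (2 * L) * ((1 / \<mu>) ^ L * exp ((1 + \<mu>) * V))"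
    using choose_row_sum[of "2 * L"]
    by (simp only: sum_distrib_right[symmetric] of_nat_sum[symmetric]) simp
  finally show ?thesis by (simp add: v_def)
qed

subsection \<open>Zero padding\<close>

text \<open>This is \<open>(A + B)^m\<close> applied to \<open>f\<close>, where \<open>A\<close> and
  \<open>B\<close> raise \<open>p\<close> and \<open>l\<close>. These count the zeros sent through
  the channel on the left and right; \<open>i\<close> and \<open>j\<close> count zeros added after
  it.\<close>

fun pair_sum :: "(nat \<Rightarrow> nat \<Rightarrow> nat \<Rightarrow> nat \<Rightarrow> real) \<Rightarrow> nat \<Rightarrow> nat \<Rightarrow> nat \<Rightarrow> nat \<Rightarrow> nat \<Rightarrow> real" where
  "pair_sum f 0 i j p l = f i j p l"
| "pair_sum f (Suc m) i j p l = pair_sum f m i j (Suc p) l + pair_sum f m i j p (Suc l)"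

text \<open>The binomial theorem for the commuting shifts of \<open>p\<close> and
  \<open>l\<close>.\<close>

lemma pair_sum_binomial:
  "pair_sum f m i j p l = (\<Sum>s\<le>m. real (m choose s) * f i j (p + s) (l + (m - s)))"
proof (induction m arbitrary: p l)
  case (Suc m)
  have "(\<Sum>s\<le>m. real (m choose s) * f i j (p + s) (Suc l + (m - s)))
     = (\<Sum>s\<le>m. real (m choose s) * f i j (p + s) (l + (Suc m - s)))"
    by (intro sum.cong) (auto simp: Suc_diff_le)
  then show ?case
    unfolding binomial_sum_Suc by (simp add: Suc)
qed simp

text \<open>Both equations condition on the fate of the outermost padding zero: it is deleted or
  becomes an undeleted zero at the same end.\<close>

locale zero_padding =
  fixes f :: "nat \<Rightarrow> nat \<Rightarrow> nat \<Rightarrow> nat \<Rightarrow> real" and d :: real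
  assumes left: "f i j (Suc p) l = d * f i j p l + (1 - d) * f (Suc i) j p l"
    and right: "f i j p (Suc l) = d * f i j p l + (1 - d) * f i (Suc j) p l"
begin

lemma pair_sum_left:
  "pair_sum f m i j (Suc p) l = d * pair_sum f m i j p l + (1 - d) * pair_sum f m (Suc i) j p l"
  by (induction m arbitrary: p l) (simp_all add: left algebra_simps)

lemma pair_sum_right:
  "pair_sum f m i j p (Suc l) = d * pair_sum f m i j p l + (1 - d) * pair_sum f m i (Suc j) p l"
  by (induction m arbitrary: p l) (simp_all add: right algebra_simps)

text \<open>Expanding both recursions produces the cross terms \<open>d * (1 - d) * (z + w)\<close>,
  which equal \<open>d * (A + B) - 2 * d\<^sup>2\<close>.\<close>

lemma pair_sum_both:
  "pair_sum f m i j (Suc p) (Suc l) = (1 - d)\<^sup>2 * pair_sum f m (Suc i) (Suc j) p l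
     - d\<^sup>2 * pair_sum f m i j p l + d * pair_sum f (Suc m) i j p l"
  by (simp add: pair_sum_left pair_sum_right power2_eq_square algebra_simps)

lemma pair_sum_abs_le:
  assumes "\<And>i j p l. \<bar>f i j p l\<bar> \<le> Z"
  shows "\<bar>pair_sum f m i j p l\<bar> \<le> 2 ^ m * Z"
proof (induction m arbitrary: p l)
  case (Suc m)
  show ?case using Suc[of "Suc p" l] Suc[of p "Suc l"] by simp
qed (simp add: assms)

text \<open>Removing one zero at each end leaves terms whose coefficients sum in absolute value to
  at most \<open>1 - d / 2\<close>. The order \<open>m\<close> may rise, but at \<open>M\<close> the
  bound \<epsilon> takes over. The surplus \<open>l\<close> on the right is carried along.\<close>

lemma abs_pair_sum_le_decay:
  assumes d: "0 \<le> d" "d \<le> 1 / 4" and Z: "\<And>i j p l. \<bar>f i j p l\<bar> \<le> Z"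
    and M: "\<And>i j p l. \<bar>pair_sum f M i j p l\<bar> \<le> \<epsilon>" and m: "m \<le> M"
  shows "\<bar>pair_sum f m i j q (q + l)\<bar> \<le> 2 ^ M * Z * (1 - d / 2) ^ q + \<epsilon>"
  using m
proof (induction q arbitrary: m i j)
  case 0
  have Z0: "Z \<ge> 0" using Z[of 0 0 0 0] by linarith
  have "\<epsilon> \<ge> 0" using M[of 0 0 0 0] by linarith
  moreover have "\<bar>pair_sum f m i j 0 (0 + l)\<bar> \<le> 2 ^ m * Z"
    by (rule pair_sum_abs_le[OF Z])
  moreover have "2 ^ m * Z \<le> 2 ^ M * Z"
    using 0 Z0 by (intro mult_right_mono power_increasing) auto
  ultimately show ?case by simp
next
  case (Suc q)
  have Z0: "Z \<ge> 0" using Z[of 0 0 0 0] by linarith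
  have \<epsilon>: "\<epsilon> \<ge> 0" using M[of 0 0 0 0] by linarith
  define D where "D = 2 ^ M * Z * (1 - d / 2) ^ q"
  have D0: "D \<ge> 0" using Z0 d by (simp add: D_def)
  \<comment> \<open>The left side is \<open>1 - d + 2 * d\<^sup>2\<close>, and
    \<open>d \<le> 1 / 4\<close> gives \<open>2 * d\<^sup>2 \<le> d / 2\<close>.\<close>
  have \<kappa>: "(1 - d)\<^sup>2 + d\<^sup>2 + d \<le> 1 - d / 2"
    using mult_left_mono[of d "1 / 4" d] d by (simp add: power2_eq_square algebra_simps)
  show ?case
  proof (cases "m = M")
    case True
    have "0 \<le> 2 ^ M * Z * (1 - d / 2) ^ Suc q" using Z0 d by simp
    then show ?thesis unfolding True using M[of i j "Suc q" "Suc q + l"] by linarith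
  next
    case False
    then have "Suc m \<le> M" using Suc.prems by simp
    from Suc.IH[OF Suc.prems] Suc.IH[OF this]
    have b: "\<bar>pair_sum f m i j q (q + l)\<bar> \<le> D + \<epsilon>" "\<bar>pair_sum f (Suc m) i j q (q + l)\<bar> \<le> D + \<epsilon>" for i j
      by (simp_all only: D_def)
    have "\<bar>pair_sum f m i j (Suc q) (Suc q + l)\<bar> \<le>
       (1 - d)\<^sup>2 * \<bar>pair_sum f m (Suc i) (Suc j) q (q + l)\<bar> + d\<^sup>2 * \<bar>pair_sum f m i j q (q + l)\<bar>
         + d * \<bar>pair_sum f (Suc m) i j q (q + l)\<bar>"
    proof -
      have "\<bar>x * a - y * b + z * c\<bar> \<le> x * \<bar>a\<bar> + y * \<bar>b\<bar> + z * \<bar>c\<bar>"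
        if "0 \<le> x" "0 \<le> y" "0 \<le> z" for x y z a b c :: real
      proof -
        have "\<bar>x * a - y * b + z * c\<bar> \<le> \<bar>x * a\<bar> + \<bar>y * b\<bar> + \<bar>z * c\<bar>" by linarith
        then show ?thesis using that by (simp add: abs_mult)
      qed
      then show ?thesis unfolding add_Suc pair_sum_both using d(1) by (metis zero_le_power2)
    qed
    also have "\<dots> \<le> (1 - d)\<^sup>2 * (D + \<epsilon>) + d\<^sup>2 * (D + \<epsilon>) + d * (D + \<epsilon>)"
      using d(1) b by (intro add_mono mult_left_mono) auto
    also have "\<dots> = ((1 - d)\<^sup>2 + d\<^sup>2 + d) * (D + \<epsilon>)" by (simp add: algebra_simps)
    also have "\<dots> \<le> (1 - d / 2) * (D + \<epsilon>)"
      using \<kappa> D0 \<epsilon> by (intro mult_right_mono) auto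
    \<comment> \<open>As the factor is at most 1, \<epsilon> does not accumulate over the
      steps.\<close>
    also have "\<dots> \<le> (1 - d / 2) * D + \<epsilon>"
      using d(1) \<epsilon> by (simp add: algebra_simps)
    finally show ?thesis by (simp add: D_def mult_ac)
  qed
qed

end

subsection \<open>Signed Gaussian weights\<close>

text \<open>A bump of width \<open>h\<close> at the centre of the window. The argument is real since
  translated points \<open>real i - s\<close> may be negative.\<close>

definition gauss_weight :: "real \<Rightarrow> nat \<Rightarrow> real \<Rightarrow> real" where
  "gauss_weight \<rho> h x = \<rho> * exp (- ((x - (real h)\<^sup>2) / real h)\<^sup>2)"

definition scaled_dist :: "nat \<Rightarrow> nat \<Rightarrow> real" where
  "scaled_dist h i = \<bar>real i - (real h)\<^sup>2\<bar> / real h"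

text \<open>The exponent collects, for one point, the Gaussian term, its share
  \<open>4 * y + 4\<close> of the shift exponent as magnified by the Taylor remainder, and a reserve
  \<open>4 * y + 8\<close> for points near the border.\<close>

definition majorant :: "real \<Rightarrow> real \<Rightarrow> nat \<Rightarrow> nat \<Rightarrow> real" where
  "majorant \<rho> \<mu> h i = (let y = scaled_dist h i in
     \<rho> * exp (- y\<^sup>2 + (1 + \<mu>) * (4 * y + 4) + (4 * y + 8)))"

lemma scaled_dist_nonneg [simp]: "0 \<le> scaled_dist h i"
  by (simp add: scaled_dist_def)

lemma gauss_weight_nonneg: "0 \<le> \<rho> \<Longrightarrow> 0 \<le> gauss_weight \<rho> h x"
  by (simp add: gauss_weight_def)

lemma gauss_weight_nat: "gauss_weight \<rho> h (real i) = \<rho> * exp (- (scaled_dist h i)\<^sup>2)"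
  by (simp add: gauss_weight_def scaled_dist_def power_divide)

text \<open>Expanding the square turns a shift into the exponential of a quadratic in
  \<open>s\<close> without constant term, the form treated by
  \<open>alternating_binomial_exp_quadratic\<close>.\<close>

lemma prod_gauss_weight_shift:
  assumes "h > 0"
  shows "(\<Prod>i\<in>X. gauss_weight \<rho> h (real i - s)) = (\<Prod>i\<in>X. gauss_weight \<rho> h (real i)) *
     exp ((\<Sum>i\<in>X. 2 * (real i - (real h)\<^sup>2) / (real h)\<^sup>2) * s + (- real (card X) / (real h)\<^sup>2) * s\<^sup>2)"
proof (cases "finite X")
  case True
  have "gauss_weight \<rho> h (real i - s) = gauss_weight \<rho> h (real i) *
      exp (2 * (real i - (real h)\<^sup>2) / (real h)\<^sup>2 * s + - 1 / (real h)\<^sup>2 * s\<^sup>2)" for i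
  proof -
    have "- ((A - s) / k)\<^sup>2 = - (A / k)\<^sup>2 + (2 * A / k\<^sup>2 * s + - 1 / k\<^sup>2 * s\<^sup>2)" if "k \<noteq> 0" for A k :: real
      using that by (simp add: power2_eq_square field_simps)
    from this[of "real h" "real i - (real h)\<^sup>2"]
    have "- ((real i - s - (real h)\<^sup>2) / real h)\<^sup>2 = - ((real i - (real h)\<^sup>2) / real h)\<^sup>2
        + (2 * (real i - (real h)\<^sup>2) / (real h)\<^sup>2 * s + - 1 / (real h)\<^sup>2 * s\<^sup>2)"
      using assms by (simp add: algebra_simps)
    then show ?thesis unfolding gauss_weight_def by (simp only: exp_add mult.assoc)
  qed
  moreover have "(\<Sum>i\<in>X. 2 * (real i - (real h)\<^sup>2) / (real h)\<^sup>2 * s + - 1 / (real h)\<^sup>2 * s\<^sup>2)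
     = (\<Sum>i\<in>X. 2 * (real i - (real h)\<^sup>2) / (real h)\<^sup>2) * s + (- real (card X) / (real h)\<^sup>2) * s\<^sup>2"
    by (simp only: sum.distrib sum_distrib_right[symmetric] sum_constant) simp
  ultimately show ?thesis
    using True by (simp only: prod.distrib exp_sum[symmetric])
qed simp

text \<open>With \<open>t = s / h\<close> in \<open>[0, 2]\<close> and \<open>z\<close> the signed
  scaled distance, a point contributes \<open>2 * z * t - t\<^sup>2\<close>.\<close>

lemma abs_shift_exponent_le:
  assumes "h > 0" "s \<le> 2 * h"
  shows "\<bar>(\<Sum>i\<in>X. 2 * (real i - (real h)\<^sup>2) / (real h)\<^sup>2) * real s + (- real (card X) / (real h)\<^sup>2) * (real s)\<^sup>2\<bar>
     \<le> (\<Sum>i\<in>X. 4 * scaled_dist h i + 4)"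
proof -
  have "\<bar>2 * (real i - (real h)\<^sup>2) / (real h)\<^sup>2 * real s + - 1 / (real h)\<^sup>2 * (real s)\<^sup>2\<bar> \<le> 4 * scaled_dist h i + 4" for i
  proof -
    define t where "t = real s / real h"
    define z where "z = (real i - (real h)\<^sup>2) / real h"
    have t: "0 \<le> t" "t \<le> 2" using assms by (auto simp: t_def field_simps)
    have z: "\<bar>z\<bar> = scaled_dist h i" by (simp add: z_def scaled_dist_def)
    have e: "2 * (real i - (real h)\<^sup>2) / (real h)\<^sup>2 * real s + - 1 / (real h)\<^sup>2 * (real s)\<^sup>2 = 2 * z * t - t\<^sup>2"
      by (simp add: z_def t_def power2_eq_square)
    have "\<bar>2 * z * t - t\<^sup>2\<bar> \<le> 2 * (\<bar>z\<bar> * t) + t\<^sup>2"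
      using t by (simp add: abs_mult order_trans[OF abs_triangle_ineq4])
    moreover have "\<bar>z\<bar> * t \<le> \<bar>z\<bar> * 2" using t by (intro mult_left_mono) auto
    moreover have "t\<^sup>2 \<le> 2\<^sup>2" using t by (intro power_mono) auto
    ultimately show ?thesis unfolding e z by simp
  qed
  then have "\<bar>\<Sum>i\<in>X. 2 * (real i - (real h)\<^sup>2) / (real h)\<^sup>2 * real s + - 1 / (real h)\<^sup>2 * (real s)\<^sup>2\<bar>
      \<le> (\<Sum>i\<in>X. 4 * scaled_dist h i + 4)"
    by (intro order_trans[OF sum_abs] sum_mono)
  moreover have "(\<Sum>i\<in>X. 2 * (real i - (real h)\<^sup>2) / (real h)\<^sup>2 * real s + - 1 / (real h)\<^sup>2 * (real s)\<^sup>2)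
     = (\<Sum>i\<in>X. 2 * (real i - (real h)\<^sup>2) / (real h)\<^sup>2) * real s + (- real (card X) / (real h)\<^sup>2) * (real s)\<^sup>2"
    by (simp only: sum.distrib sum_distrib_right[symmetric] sum_constant) simp
  ultimately show ?thesis by (simp only:)
qed

lemma sum_choose_mult_le:
  assumes "\<And>s. s \<le> m \<Longrightarrow> \<bar>g s\<bar> \<le> (B::real)"
  shows "\<bar>\<Sum>s\<le>m. real (m choose s) * g s\<bar> \<le> 2 ^ m * B"
proof -
  have "\<bar>\<Sum>s\<le>m. real (m choose s) * g s\<bar> \<le> (\<Sum>s\<le>m. real (m choose s) * B)"
    using assms by (intro order_trans[OF sum_abs] sum_mono) (auto simp: abs_mult intro: mult_left_mono)
  also have "\<dots> = 2 ^ m * B"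
    using choose_row_sum[of m] by (simp only: sum_distrib_right[symmetric] of_nat_sum[symmetric]) simp
  finally show ?thesis .
qed

text \<open>If \<open>X\<close> survives all shifts inside the window, the Taylor cancellation applies. Otherwise \<open>X\<close> has a
  point with \<open>scaled_dist h i \<ge> h - 2\<close>, and the factor \<open>exp (4 * y + 8)\<close> in the majorant of that single
  point already compensates for \<open>(1 / exp 4) ^ h\<close>.\<close>

lemma alternating_gauss_weight_le:
  assumes h: "h > 0" and \<rho>: "\<rho> \<ge> 0" and X: "X \<subseteq> {..<2 * h\<^sup>2 + 2 * h}"
  shows "\<bar>\<Sum>s\<le>2 * h. real (2 * h choose s) * ((-1) ^ s * (of_bool (X \<subseteq> {s..<s + 2 * h\<^sup>2}) *
      (\<Prod>i\<in>X. gauss_weight \<rho> h (real i - real s))))\<bar>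
    \<le> 2 ^ (2 * h) * ((1 / exp 4) ^ h * (\<Prod>i\<in>X. majorant \<rho> (exp 4) h i))"
proof -
  define G where "G = (\<Prod>i\<in>X. gauss_weight \<rho> h (real i))"
  define V where "V = (\<Sum>i\<in>X. 4 * scaled_dist h i + 4)"
  define W where "W = (\<Sum>i\<in>X. 4 * scaled_dist h i + 8)"
  define a where "a = (\<Sum>i\<in>X. 2 * (real i - (real h)\<^sup>2) / (real h)\<^sup>2)"
  define b where "b = - real (card X) / (real h)\<^sup>2"
  have fX: "finite X" using X finite_subset by blast
  have G0: "G \<ge> 0" unfolding G_def by (intro prod_nonneg) (simp add: gauss_weight_nonneg \<rho>)
  have V0: "V \<ge> 0" and W0: "W \<ge> 0" unfolding V_def W_def by (auto intro!: sum_nonneg add_nonneg_nonneg)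
  have prod: "(\<Prod>i\<in>X. gauss_weight \<rho> h (real i - real s)) = G * exp (a * real s + b * (real s)\<^sup>2)" for s
    unfolding G_def a_def b_def by (rule prod_gauss_weight_shift[OF h])
  have V: "\<bar>a * real s + b * (real s)\<^sup>2\<bar> \<le> V" if "s \<le> 2 * h" for s
    unfolding a_def b_def V_def by (rule abs_shift_exponent_le[OF h that])
  have maj: "(\<Prod>i\<in>X. majorant \<rho> (exp 4) h i) = G * (exp ((1 + exp 4) * V) * exp W)"
    unfolding G_def V_def W_def sum_distrib_left exp_sum[OF fX] prod.distrib[symmetric]
    by (intro prod.cong) (simp_all only: majorant_def Let_def gauss_weight_nat exp_add mult.assoc)
  show ?thesis
  proof (cases "X \<subseteq> {2 * h..<2 * h\<^sup>2}")
    case True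
    then have "of_bool (X \<subseteq> {s..<s + 2 * h\<^sup>2}) = (1::real)" if "s \<le> 2 * h" for s
      using that by (auto simp: subset_iff)
    then have "(\<Sum>s\<le>2 * h. real (2 * h choose s) * ((-1) ^ s * (of_bool (X \<subseteq> {s..<s + 2 * h\<^sup>2}) *
        (\<Prod>i\<in>X. gauss_weight \<rho> h (real i - real s)))))
      = G * (\<Sum>s\<le>2 * h. real (2 * h choose s) * ((-1) ^ s * exp (a * real s + b * (real s)\<^sup>2)))"
      unfolding prod sum_distrib_left by (intro sum.cong) auto
    also have "\<bar>\<dots>\<bar> \<le> G * (2 ^ (2 * h) * ((1 / exp 4) ^ h * exp ((1 + exp 4) * V)))"
      using alternating_binomial_exp_quadratic[of h "exp 4" a b V] h V G0
      by (simp add: abs_mult mult_left_mono)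
    also have "\<dots> \<le> G * (2 ^ (2 * h) * ((1 / exp 4) ^ h * (exp ((1 + exp 4) * V) * exp W)))"
      using W0 G0 by (intro mult_left_mono) auto
    also have "\<dots> = 2 ^ (2 * h) * ((1 / exp 4) ^ h * (\<Prod>i\<in>X. majorant \<rho> (exp 4) h i))"
      unfolding maj by (simp only: mult_ac)
    finally show ?thesis .
  next
    case False
    then obtain i where i: "i \<in> X" "i < 2 * h \<or> 2 * h\<^sup>2 \<le> i" by (auto simp: subset_iff not_le)
    have "real h - 2 \<le> scaled_dist h i"
    proof -
      have "real i \<le> 2 * real h \<or> 2 * (real h)\<^sup>2 \<le> real i"
      proof (cases "i < 2 * h")
        case False
        then have "real (2 * h\<^sup>2) \<le> real i" using i(2) by (subst of_nat_le_iff) simp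
        then show ?thesis by simp
      qed linarith
      then have "(real h - 2) * real h \<le> \<bar>real i - (real h)\<^sup>2\<bar>"
        by (auto simp: power2_eq_square algebra_simps)
      then show ?thesis using h by (simp add: scaled_dist_def field_simps)
    qed
    moreover have "4 * scaled_dist h i + 8 \<le> W"
      unfolding W_def using fX i(1)
      by (intro member_le_sum[of i X "\<lambda>i. 4 * scaled_dist h i + 8"]) auto
    ultimately have "exp (4 * real h) \<le> exp W" by simp
    then have W: "1 \<le> (1 / exp 4) ^ h * exp W"
      by (simp add: power_divide exp_of_nat_mult[symmetric] mult.commute)
    have "\<bar>\<Sum>s\<le>2 * h. real (2 * h choose s) * ((-1) ^ s * (of_bool (X \<subseteq> {s..<s + 2 * h\<^sup>2}) *
        (\<Prod>i\<in>X. gauss_weight \<rho> h (real i - real s))))\<bar> \<le> 2 ^ (2 * h) * (G * exp V)"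
    proof (rule sum_choose_mult_le)
      fix s assume "s \<le> 2 * h"
      then have "G * exp (a * real s + b * (real s)\<^sup>2) \<le> G * exp V"
        using V[of s] G0 by (intro mult_left_mono) auto
      then show "\<bar>(-1) ^ s * (of_bool (X \<subseteq> {s..<s + 2 * h\<^sup>2}) * (\<Prod>i\<in>X. gauss_weight \<rho> h (real i - real s)))\<bar>
          \<le> G * exp V"
        unfolding prod using G0 by (simp add: abs_mult)
    qed
    also have "\<dots> \<le> 2 ^ (2 * h) * (G * (exp ((1 + exp 4) * V) * ((1 / exp 4) ^ h * exp W)))"
    proof -
      have "V \<le> (1 + exp 4) * V" using V0 by (simp add: algebra_simps)
      then have "exp V * 1 \<le> exp ((1 + exp 4) * V) * ((1 / exp 4) ^ h * exp W)"
        using W by (intro mult_mono) auto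
      then show ?thesis using G0 by (intro mult_left_mono) auto
    qed
    also have "\<dots> = 2 ^ (2 * h) * ((1 / exp 4) ^ h * (\<Prod>i\<in>X. majorant \<rho> (exp 4) h i))"
      unfolding maj by (simp only: mult_ac)
    finally show ?thesis .
  qed
qed

section \<open>Sign change under translation\<close>

definition parity_sign :: "nat set \<Rightarrow> real" where
  "parity_sign X = of_bool (\<forall>i\<in>X. odd i) - of_bool (\<forall>i\<in>X. even i)"

lemma abs_parity_sign_le: "\<bar>parity_sign X\<bar> \<le> 1"
  by (simp add: parity_sign_def)

text \<open>An odd translation swaps the two parities and an even one keeps them. This is the source
  of the signs in the alternating sums.\<close>

lemma parity_sign_shift: "parity_sign X = (-1) ^ s * parity_sign ((+) s ` X)"
  by (cases "even s") (auto simp: parity_sign_def)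

definition signed_weight :: "real \<Rightarrow> nat \<Rightarrow> nat set \<Rightarrow> real" where
  "signed_weight \<rho> h X = parity_sign X * (\<Prod>i\<in>X. gauss_weight \<rho> h (real i))"

text \<open>Substituting \<open>Y = s + X\<close> moves the translation from the test function to
  the weights. The index set no longer depends on \<open>s\<close>, so sums over \<open>s\<close>
  and \<open>Y\<close> can be exchanged.\<close>

lemma sum_signed_weight_shift:
  assumes "s \<le> m"
  shows "(\<Sum>X\<in>Pow {..<u}. signed_weight \<rho> h X * \<phi> ((+) s ` X))
    = (\<Sum>Y\<in>Pow {..<u + m}. (-1) ^ s * (of_bool (Y \<subseteq> {s..<s + u}) *
         (\<Prod>i\<in>Y. gauss_weight \<rho> h (real i - real s))) * (parity_sign Y * \<phi> Y))"
proof -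
  let ?g = "\<lambda>Y. (-1) ^ s * (\<Prod>i\<in>Y. gauss_weight \<rho> h (real i - real s)) * (parity_sign Y * \<phi> Y)"
  have img: "(`) ((+) s) ` Pow {..<u} = Pow {s..<s + u}"
  proof -
    have "(+) s ` {..<u} = {s..<s + u}"
      using image_add_atLeastLessThan[of s 0 u] by (simp add: atLeast0LessThan add.commute)
    then show ?thesis by (simp add: image_Pow_surj)
  qed
  have inj: "inj_on ((`) ((+) s)) (Pow {..<u})"
    by (intro inj_onI) (simp add: inj_image_eq_iff)
  have "(\<Sum>X\<in>Pow {..<u}. signed_weight \<rho> h X * \<phi> ((+) s ` X)) = (\<Sum>X\<in>Pow {..<u}. ?g ((+) s ` X))"
  proof (rule sum.cong[OF refl])
    fix X
    show "signed_weight \<rho> h X * \<phi> ((+) s ` X) = ?g ((+) s ` X)"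
      unfolding signed_weight_def parity_sign_shift[of X s] by (subst prod.reindex) simp_all
  qed
  also have "\<dots> = (\<Sum>Y\<in>Pow {s..<s + u}. ?g Y)"
    unfolding img[symmetric] by (subst sum.reindex[OF inj]) simp
  also have "\<dots> = (\<Sum>Y\<in>Pow {..<u + m}. if Y \<subseteq> {s..<s + u} then ?g Y else 0)"
  proof -
    have "Pow {..<u + m} \<inter> {Y. Y \<subseteq> {s..<s + u}} = Pow {s..<s + u}"
      using assms by force
    then show ?thesis by (simp add: sum.If_cases)
  qed
  also have "\<dots> = (\<Sum>Y\<in>Pow {..<u + m}. (-1) ^ s * (of_bool (Y \<subseteq> {s..<s + u}) *
         (\<Prod>i\<in>Y. gauss_weight \<rho> h (real i - real s))) * (parity_sign Y * \<phi> Y))"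
    by (intro sum.cong) auto
  finally show ?thesis .
qed

lemma sum_prod_Pow: "finite A \<Longrightarrow> (\<Sum>X\<in>Pow A. \<Prod>i\<in>X. r i) = (\<Prod>i\<in>A. 1 + (r i :: real))"
  using prod_add[of A r "\<lambda>_. 1"] by (simp add: add.commute)

text \<open>After exchanging the sums, each \<open>Y\<close> carries an alternating sum in
  \<open>s\<close>. Its bound is a product over the points of \<open>Y\<close>, so the sum over all
  \<open>Y\<close> factorizes.\<close>

lemma alternating_signed_weight_le:
  assumes h: "h > 0" and \<rho>: "\<rho> \<ge> 0" and \<phi>: "\<And>X. \<bar>\<phi> X\<bar> \<le> 1"
  shows "\<bar>\<Sum>s\<le>2 * h. real (2 * h choose s) * (\<Sum>X\<in>Pow {..<2 * h\<^sup>2}. signed_weight \<rho> h X * \<phi> ((+) s ` X))\<bar>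
    \<le> 2 ^ (2 * h) * (1 / exp 4) ^ h * (\<Prod>i<2 * h\<^sup>2 + 2 * h. 1 + majorant \<rho> (exp 4) h i)"
proof -
  let ?t = "\<lambda>s Y. (-1) ^ s * (of_bool (Y \<subseteq> {s..<s + 2 * h\<^sup>2}) * (\<Prod>i\<in>Y. gauss_weight \<rho> h (real i - real s)))"
  have "(\<Sum>s\<le>2 * h. real (2 * h choose s) * (\<Sum>X\<in>Pow {..<2 * h\<^sup>2}. signed_weight \<rho> h X * \<phi> ((+) s ` X)))
    = (\<Sum>s\<le>2 * h. \<Sum>Y\<in>Pow {..<2 * h\<^sup>2 + 2 * h}. real (2 * h choose s) * ?t s Y * (parity_sign Y * \<phi> Y))"
    by (intro sum.cong[OF refl]) (simp add: sum_signed_weight_shift[where m = "2 * h"] sum_distrib_left mult.assoc)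
  also have "\<dots> = (\<Sum>Y\<in>Pow {..<2 * h\<^sup>2 + 2 * h}. (\<Sum>s\<le>2 * h. real (2 * h choose s) * ?t s Y) * (parity_sign Y * \<phi> Y))"
    by (subst sum.swap) (simp only: sum_distrib_right)
  also have "\<bar>\<dots>\<bar> \<le> (\<Sum>Y\<in>Pow {..<2 * h\<^sup>2 + 2 * h}. 2 ^ (2 * h) * ((1 / exp 4) ^ h * (\<Prod>i\<in>Y. majorant \<rho> (exp 4) h i)))"
  proof (rule order_trans[OF sum_abs], rule sum_mono)
    fix Y assume Y: "Y \<in> Pow {..<2 * h\<^sup>2 + 2 * h}"
    have "\<bar>(\<Sum>s\<le>2 * h. real (2 * h choose s) * ?t s Y) * (parity_sign Y * \<phi> Y)\<bar>
       \<le> \<bar>\<Sum>s\<le>2 * h. real (2 * h choose s) * ?t s Y\<bar> * (1 * 1)"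
      unfolding abs_mult by (intro mult_mono abs_parity_sign_le \<phi>) auto
    also have "\<dots> \<le> 2 ^ (2 * h) * ((1 / exp 4) ^ h * (\<Prod>i\<in>Y. majorant \<rho> (exp 4) h i))"
      using alternating_gauss_weight_le[OF h \<rho>, of Y] Y by simp
    finally show "\<bar>(\<Sum>s\<le>2 * h. real (2 * h choose s) * ?t s Y) * (parity_sign Y * \<phi> Y)\<bar>
       \<le> 2 ^ (2 * h) * ((1 / exp 4) ^ h * (\<Prod>i\<in>Y. majorant \<rho> (exp 4) h i))" .
  qed
  also have "\<dots> = 2 ^ (2 * h) * (1 / exp 4) ^ h * (\<Prod>i<2 * h\<^sup>2 + 2 * h. 1 + majorant \<rho> (exp 4) h i)"
    by (simp only: sum_distrib_left[symmetric] sum_prod_Pow finite_lessThan mult.assoc)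
  finally show ?thesis .
qed

section \<open>Words between zero paddings\<close>

lemma indicator_word_shift:
  assumes "X \<subseteq> {..<u}" "s \<le> m"
  shows "replicate (p + s) False @ indicator_word u X @ replicate (l + (m - s)) False
     = replicate p False @ indicator_word (u + m) ((+) s ` X) @ replicate l False"
proof -
  \<comment> \<open>The window absorbs \<open>s\<close> zeros on the left and \<open>m - s\<close>
    on the right; the padding that remains is independent of \<open>s\<close>.\<close>
  have "replicate s False @ indicator_word u X @ replicate (m - s) False = indicator_word (u + m) ((+) s ` X)"
  proof (rule nth_equalityI)
    fix i assume "i < length (replicate s False @ indicator_word u X @ replicate (m - s) False)"
    then have "i < u + m" using assms(2) by (simp add: indicator_word_def)
    moreover have "i \<in> (+) s ` X \<longleftrightarrow> s \<le> i \<and> i - s \<in> X"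
      by (auto simp: image_iff intro: bexI[of _ "i - s"])
    ultimately show "(replicate s False @ indicator_word u X @ replicate (m - s) False) ! i
        = indicator_word (u + m) ((+) s ` X) ! i"
      using assms by (auto simp: indicator_word_def nth_append)
  qed (use assms(2) in \<open>simp add: indicator_word_def\<close>)
  moreover have "replicate (l + (m - s)) False = replicate (m - s) False @ replicate l False"
    by (simp only: replicate_add[symmetric] add.commute)
  ultimately show ?thesis by (simp add: replicate_add)
qed

text \<open>At \<open>i = j = 0\<close> this is a difference of unnormalized expectations under the
  two laws; positive \<open>i\<close> and \<open>j\<close> arise when padding zeros survive.\<close>

definition padded_expect :: "real \<Rightarrow> nat \<Rightarrow> real \<Rightarrow> (bool list \<Rightarrow> real) \<Rightarrow> nat \<Rightarrow> nat \<Rightarrow> nat \<Rightarrow> nat \<Rightarrow> real" where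
  "padded_expect \<rho> h d g i j p l = (\<Sum>X\<in>Pow {..<2 * h\<^sup>2}. signed_weight \<rho> h X *
     expect (deletion_channel d (replicate p False @ indicator_word (2 * h\<^sup>2) X @ replicate l False))
       (\<lambda>t. g (replicate i False @ t @ replicate j False)))"

lemma zero_padding_padded_expect:
  assumes d: "0 \<le> d" "d \<le> 1"
  shows "zero_padding (padded_expect \<rho> h d g) d"
proof
  fix i j p l
  note [simp] = expect_bind_finite finite_set_deletion_channel map_pmf_def bind_assoc_pmf bind_return_pmf d
  have "expect (deletion_channel d (replicate (Suc p) False @ w)) (\<lambda>t. g (replicate i False @ t @ replicate j False))
      = d * expect (deletion_channel d (replicate p False @ w)) (\<lambda>t. g (replicate i False @ t @ replicate j False))
      + (1 - d) * expect (deletion_channel d (replicate p False @ w)) (\<lambda>t. g (replicate (Suc i) False @ t @ replicate j False))" for w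
    by (simp add: replicate_app_Cons_same)
  then show "padded_expect \<rho> h d g i j (Suc p) l
      = d * padded_expect \<rho> h d g i j p l + (1 - d) * padded_expect \<rho> h d g (Suc i) j p l"
    unfolding padded_expect_def by (simp only: sum_distrib_left sum.distrib[symmetric] distrib_left mult.left_commute)
  have "expect (deletion_channel d (w @ replicate (Suc l) False)) (\<lambda>t. g (replicate i False @ t @ replicate j False))
      = d * expect (deletion_channel d (w @ replicate l False)) (\<lambda>t. g (replicate i False @ t @ replicate j False))
      + (1 - d) * expect (deletion_channel d (w @ replicate l False)) (\<lambda>t. g (replicate i False @ t @ replicate (Suc j) False))" for w
  proof -
    \<comment> \<open>The channel recurses from the left, so the last zero is split off with
      \<open>deletion_channel_append\<close>.\<close>
    have "replicate (Suc l) False = replicate l False @ [False]"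
      by (simp add: replicate_append_same)
    then have "deletion_channel d (w @ replicate (Suc l) False)
       = bind_pmf (deletion_channel d (w @ replicate l False)) (\<lambda>a. map_pmf (\<lambda>b. a @ b) (deletion_channel d [False]))"
      by (metis append_assoc deletion_channel_append)
    then show ?thesis
      by (simp add: integrable_measure_pmf_finite)
  qed
  from this[of "replicate p False @ _"] show "padded_expect \<rho> h d g i j p (Suc l)
      = d * padded_expect \<rho> h d g i j p l + (1 - d) * padded_expect \<rho> h d g i (Suc j) p l"
    unfolding padded_expect_def append_assoc
    by (simp only: sum_distrib_left sum.distrib[symmetric] distrib_left mult.left_commute)
qed


lemma padded_expect_abs_le:
  assumes \<rho>: "0 \<le> \<rho>" and g: "\<And>t. \<bar>g t\<bar> \<le> 1"
  shows "\<bar>padded_expect \<rho> h d g i j p l\<bar> \<le> (\<Prod>i<2 * h\<^sup>2. 1 + gauss_weight \<rho> h (real i))"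
proof -
  have "\<bar>padded_expect \<rho> h d g i j p l\<bar> \<le> (\<Sum>X\<in>Pow {..<2 * h\<^sup>2}. \<Prod>i\<in>X. gauss_weight \<rho> h (real i))"
    unfolding padded_expect_def
  proof (rule order_trans[OF sum_abs], rule sum_mono)
    fix X :: "nat set"
    let ?E = "expect (deletion_channel d (replicate p False @ indicator_word (2 * h\<^sup>2) X @ replicate l False))
         (\<lambda>t. g (replicate i False @ t @ replicate j False))"
    have P: "0 \<le> (\<Prod>i\<in>X. gauss_weight \<rho> h (real i))"
      by (intro prod_nonneg) (simp add: gauss_weight_nonneg \<rho>)
    have "\<bar>signed_weight \<rho> h X * ?E\<bar> = (\<Prod>i\<in>X. gauss_weight \<rho> h (real i)) * (\<bar>parity_sign X\<bar> * \<bar>?E\<bar>)"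
      using P by (simp add: signed_weight_def abs_mult)
    also have "\<dots> \<le> (\<Prod>i\<in>X. gauss_weight \<rho> h (real i)) * (1 * 1)"
      using P by (intro mult_left_mono mult_mono abs_parity_sign_le expect_abs_le g) auto
    finally show "\<bar>signed_weight \<rho> h X * ?E\<bar> \<le> (\<Prod>i\<in>X. gauss_weight \<rho> h (real i))" by simp
  qed
  then show ?thesis by (simp add: sum_prod_Pow)
qed

text \<open>All terms of the binomial expansion see the same outer padding, so they evaluate one
  test function \<phi> at translated sets.\<close>

lemma pair_sum_padded_expect_le:
  assumes h: "h > 0" and \<rho>: "\<rho> \<ge> 0" and g: "\<And>t. \<bar>g t\<bar> \<le> 1"
  shows "\<bar>pair_sum (padded_expect \<rho> h d g) (2 * h) i j p l\<bar>
    \<le> 2 ^ (2 * h) * (1 / exp 4) ^ h * (\<Prod>i<2 * h\<^sup>2 + 2 * h. 1 + majorant \<rho> (exp 4) h i)"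
proof -
  define \<phi> where "\<phi> = (\<lambda>Y. expect (deletion_channel d
      (replicate p False @ indicator_word (2 * h\<^sup>2 + 2 * h) Y @ replicate l False))
       (\<lambda>t. g (replicate i False @ t @ replicate j False)))"
  have "padded_expect \<rho> h d g i j (p + s) (l + (2 * h - s))
      = (\<Sum>X\<in>Pow {..<2 * h\<^sup>2}. signed_weight \<rho> h X * \<phi> ((+) s ` X))" if "s \<le> 2 * h" for s
    unfolding padded_expect_def \<phi>_def using that
    by (intro sum.cong refl) (simp only: indicator_word_shift[of _ "2 * h\<^sup>2" s "2 * h"] Pow_iff)
  then have "pair_sum (padded_expect \<rho> h d g) (2 * h) i j p l = (\<Sum>s\<le>2 * h. real (2 * h choose s) *
      (\<Sum>X\<in>Pow {..<2 * h\<^sup>2}. signed_weight \<rho> h X * \<phi> ((+) s ` X)))"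
    unfolding pair_sum_binomial by (intro sum.cong) auto
  moreover have "\<bar>\<phi> X\<bar> \<le> 1" for X
    unfolding \<phi>_def by (intro expect_abs_le g)
  ultimately show ?thesis
    using alternating_signed_weight_le[OF h \<rho>, of \<phi>] by simp
qed

lemma padded_expect_le:
  assumes h: "h > 0" and \<rho>: "\<rho> \<ge> 0" and d: "0 \<le> d" "d \<le> 1 / 4" and g: "\<And>t. \<bar>g t\<bar> \<le> 1"
  shows "\<bar>padded_expect \<rho> h d g 0 0 q (q + l)\<bar> \<le>
     2 ^ (2 * h) * (\<Prod>i<2 * h\<^sup>2. 1 + gauss_weight \<rho> h (real i)) * (1 - d / 2) ^ q
     + 2 ^ (2 * h) * (1 / exp 4) ^ h * (\<Prod>i<2 * h\<^sup>2 + 2 * h. 1 + majorant \<rho> (exp 4) h i)"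
proof -
  interpret zero_padding "padded_expect \<rho> h d g" d
    using d by (intro zero_padding_padded_expect) auto
  show ?thesis
    using abs_pair_sum_le_decay[OF d padded_expect_abs_le[OF \<rho> g]
        pair_sum_padded_expect_le[OF h \<rho> g], of 0 0 0 q l] by simp
qed

subsection \<open>The pair of strings\<close>

lemma sum_powers_le:
  fixes x :: real
  assumes "0 \<le> x" "x < 1" "finite A" "inj_on k A"
  shows "(\<Sum>i\<in>A. x ^ k i) \<le> 1 / (1 - x)"
proof -
  have "(\<Sum>i\<in>A. x ^ k i) = (\<Sum>j\<in>k ` A. x ^ j)"
    using assms(4) by (simp add: sum.reindex)
  also have "\<dots> \<le> (\<Sum>j. x ^ j)"
    using assms by (intro sum_le_suminf) (auto simp: summable_geometric)
  also have "\<dots> = 1 / (1 - x)"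
    using assms by (simp add: suminf_geometric)
  finally show ?thesis .
qed

text \<open>There are two geometric series of ratio \<open>exp (- 1 / h)\<close>, one on each side
  of the centre, each at most \<open>h + 1 \<le> 2 * h\<close>.\<close>

lemma sum_exp_scaled_dist_le:
  assumes h: "h > 0"
  shows "(\<Sum>i<m. exp (- scaled_dist h i)) \<le> 4 * real h"
proof -
  define x where "x = exp (- 1 / real h)"
  have "exp (1 / real h) \<ge> 1 + 1 / real h" by (rule exp_ge_add_one_self)
  then have "x \<le> 1 / (1 + 1 / real h)"
    unfolding x_def using h by (simp add: exp_minus inverse_eq_divide frac_le add_pos_pos)
  also have "\<dots> = real h / (real h + 1)" using h by (simp add: field_simps)
  finally have x: "x \<le> real h / (real h + 1)" .
  then have x1: "1 / (real h + 1) \<le> 1 - x" by (simp add: field_simps)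
  then have xlt: "0 \<le> x" "x < 1" by (auto simp: x_def h)
  have inv: "1 / (1 - x) \<le> 2 * real h"
  proof -
    have "1 / (1 - x) \<le> 1 / (1 / (real h + 1))"
      using x1 xlt by (intro divide_left_mono) auto
    then show ?thesis using h by simp
  qed
  have e: "exp (- scaled_dist h i) = (if i < h\<^sup>2 then x ^ (h\<^sup>2 - i) else x ^ (i - h\<^sup>2))" for i
  proof (cases "i < h\<^sup>2")
    case True
    then have "real i < real (h\<^sup>2)" by (simp only: of_nat_less_iff)
    then show ?thesis using True h
      by (simp add: scaled_dist_def x_def exp_of_nat_mult[symmetric] of_nat_diff field_simps)
  next
    case False
    then have "real (h\<^sup>2) \<le> real i" by (simp only: of_nat_le_iff)
    then show ?thesis using False h
      by (simp add: scaled_dist_def x_def exp_of_nat_mult[symmetric] of_nat_diff field_simps)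
  qed
  have "(\<Sum>i<m. exp (- scaled_dist h i)) = (\<Sum>i\<in>{..<m} \<inter> {i. i < h\<^sup>2}. x ^ (h\<^sup>2 - i))
     + (\<Sum>i\<in>{..<m} \<inter> - {i. i < h\<^sup>2}. x ^ (i - h\<^sup>2))"
    unfolding e by (simp add: sum.If_cases)
  also have "\<dots> \<le> 2 * real h + 2 * real h"
    by (intro add_mono order_trans[OF sum_powers_le inv] xlt) (auto simp: inj_on_def)
  finally show ?thesis by simp
qed

text \<open>The maximum over real \<open>y\<close> of \<open>y\<close> plus the exponent in
  \<open>majorant\<close> at \<open>\<mu> = exp 4\<close>, so that a decay \<open>exp (- y)\<close>
  is left after scaling.\<close>

definition amplitude_exponent :: real where
  "amplitude_exponent = (4 * (1 + exp 4) + 5)\<^sup>2 / 4 + 4 * (1 + exp 4) + 8"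

text \<open>Small enough to make the total mass of the majorant at most \<open>h\<close>.\<close>

definition amplitude :: real where
  "amplitude = exp (- amplitude_exponent) / 4"

lemma amplitude_pos: "amplitude > 0"
  by (simp add: amplitude_def)

lemma amplitude_le: "amplitude \<le> 1"
proof -
  have "0 \<le> amplitude_exponent"
    unfolding amplitude_exponent_def by (intro add_nonneg_nonneg) auto
  then have "exp (- amplitude_exponent) \<le> 1" by simp
  then show ?thesis unfolding amplitude_def by linarith
qed

lemma majorant_le: "majorant amplitude (exp 4) h i \<le> exp (- scaled_dist h i) / 4"
proof -
  define y where "y = scaled_dist h i"
  define c :: real where "c = 1 + exp 4"
  have "- y\<^sup>2 + c * (4 * y + 4) + (4 * y + 8) = amplitude_exponent - y - (y - (4 * c + 5) / 2)\<^sup>2"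
    by (simp add: amplitude_exponent_def c_def[symmetric] power2_eq_square field_simps)
  also have "\<dots> \<le> amplitude_exponent - y" by simp
  finally have "exp (- y\<^sup>2 + c * (4 * y + 4) + (4 * y + 8)) \<le> exp (amplitude_exponent - y)" by simp
  then have "majorant amplitude (exp 4) h i \<le> amplitude * exp (amplitude_exponent - y)"
    using amplitude_pos by (simp add: majorant_def Let_def y_def c_def)
  also have "\<dots> = exp (- y) / 4"
    by (simp add: amplitude_def exp_add[symmetric])
  finally show ?thesis by (simp add: y_def)
qed

lemma majorant_nonneg: "0 \<le> \<rho> \<Longrightarrow> 0 \<le> majorant \<rho> \<mu> h i"
  by (simp add: majorant_def Let_def)

lemma gauss_weight_le_majorant:
  assumes "0 \<le> \<rho>" "0 \<le> \<mu>"
  shows "gauss_weight \<rho> h (real i) \<le> majorant \<rho> \<mu> h i"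
  unfolding gauss_weight_nat majorant_def Let_def using assms
  by (intro mult_left_mono) (auto intro!: add_nonneg_nonneg mult_nonneg_nonneg)

lemma sum_majorant_le:
  assumes "h > 0"
  shows "(\<Sum>i<m. majorant amplitude (exp 4) h i) \<le> real h"
proof -
  have "(\<Sum>i<m. majorant amplitude (exp 4) h i) \<le> (\<Sum>i<m. exp (- scaled_dist h i) / 4)"
    by (intro sum_mono majorant_le)
  also have "\<dots> \<le> real h"
    using sum_exp_scaled_dist_le[OF assms, of m] by (simp add: sum_divide_distrib[symmetric])
  finally show ?thesis .
qed

lemma sum_gauss_weight_le:
  assumes "h > 0"
  shows "(\<Sum>i<m. gauss_weight amplitude h (real i)) \<le> real h"
proof -
  have "(\<Sum>i<m. gauss_weight amplitude h (real i)) \<le> (\<Sum>i<m. majorant amplitude (exp 4) h i)"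
    using amplitude_pos by (intro sum_mono gauss_weight_le_majorant) auto
  then show ?thesis using sum_majorant_le[OF assms, of m] by linarith
qed

lemma prod_one_plus_le_exp:
  fixes r :: "'a \<Rightarrow> real"
  assumes "\<And>i. i \<in> A \<Longrightarrow> 0 \<le> r i" "sum r A \<le> B"
  shows "(\<Prod>i\<in>A. 1 + r i) \<le> exp B"
proof (cases "finite A")
  case True
  have "(\<Prod>i\<in>A. 1 + r i) \<le> (\<Prod>i\<in>A. exp (r i))"
    using assms(1) by (intro prod_mono) (auto simp: add_nonneg_nonneg)
  also have "\<dots> \<le> exp B" using True assms(2) by (simp add: exp_sum[symmetric])
  finally show ?thesis .
qed (use assms in auto)

text \<open>Exponents in units of \<open>h\<close>: \<open>2 ^ (2 * h)\<close> costs 2 and each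
  product costs 1, while the decay over \<open>h\<^sup>2\<close> pairs of zeros and the Taylor
  factor each gain 4. The choice \<open>d = 8 / h\<close> yields that decay, and
  \<open>32 \<le> h\<close> ensures \<open>d \<le> 1 / 4\<close>.\<close>

lemma padded_expect_amplitude_le:
  assumes h: "32 \<le> h" and g: "\<And>t. \<bar>g t\<bar> \<le> 1"
  shows "\<bar>padded_expect amplitude h (8 / real h) g 0 0 (h\<^sup>2) (h\<^sup>2 + l)\<bar> \<le> 2 * exp (- real h)"
proof -
  have h0: "h > 0" and \<rho>: "amplitude \<ge> 0" using h amplitude_pos by auto
  have d: "0 \<le> 8 / real h" "8 / real h \<le> 1 / 4" using h by (auto simp: field_simps)
  have P: "(\<Prod>i<2 * h\<^sup>2. 1 + gauss_weight amplitude h (real i)) \<le> exp (real h)"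
    by (intro prod_one_plus_le_exp sum_gauss_weight_le h0 gauss_weight_nonneg \<rho>)
  have Q: "(\<Prod>i<2 * h\<^sup>2 + 2 * h. 1 + majorant amplitude (exp 4) h i) \<le> exp (real h)"
    by (intro prod_one_plus_le_exp sum_majorant_le h0 majorant_nonneg \<rho>)
  have four: "(2::real) ^ (2 * h) \<le> exp (2 * real h)"
  proof -
    have "(2::real) \<le> exp 1" using exp_ge_add_one_self[of 1] by simp
    then have "(2::real) ^ (2 * h) \<le> exp 1 ^ (2 * h)" by (intro power_mono) auto
    then show ?thesis by (simp add: exp_of_nat_mult[symmetric])
  qed
  have decay: "(1 - 8 / real h / 2) ^ h\<^sup>2 \<le> exp (- 4 * real h)"
  proof -
    have "(1 - 8 / real h / 2) ^ h\<^sup>2 \<le> exp (- 4 / real h) ^ h\<^sup>2"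
      using d exp_ge_add_one_self[of "- 4 / real h"] by (intro power_mono) auto
    also have "\<dots> = exp (- 4 * real h)"
      using h0 by (simp add: exp_of_nat_mult[symmetric] power2_eq_square)
    finally show ?thesis .
  qed
  have e4: "(1 / exp 4) ^ h = exp (- 4 * real h)"
    by (simp add: power_divide exp_of_nat_mult[symmetric] exp_minus inverse_eq_divide mult.commute)
  have "\<bar>padded_expect amplitude h (8 / real h) g 0 0 (h\<^sup>2) (h\<^sup>2 + l)\<bar>
     \<le> 2 ^ (2 * h) * (\<Prod>i<2 * h\<^sup>2. 1 + gauss_weight amplitude h (real i)) * (1 - 8 / real h / 2) ^ h\<^sup>2
     + 2 ^ (2 * h) * (1 / exp 4) ^ h * (\<Prod>i<2 * h\<^sup>2 + 2 * h. 1 + majorant amplitude (exp 4) h i)"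
    by (rule padded_expect_le[OF h0 \<rho> d g])
  also have "\<dots> \<le> exp (2 * real h) * exp (real h) * exp (- 4 * real h)
      + exp (2 * real h) * exp (- 4 * real h) * exp (real h)"
    unfolding e4 using d
    by (intro add_mono mult_mono four P Q decay order.refl)
      (auto intro!: mult_nonneg_nonneg prod_nonneg add_nonneg_nonneg gauss_weight_nonneg majorant_nonneg \<rho>)
  also have "\<dots> = 2 * exp (- real h)"
    by (simp add: exp_add[symmetric])
  finally show ?thesis .
qed

section \<open>The two strings and their laws\<close>

definition parity_weight :: "(nat \<Rightarrow> bool) \<Rightarrow> nat \<Rightarrow> nat \<Rightarrow> real" where
  "parity_weight P h i = (if P i then gauss_weight amplitude h (real i) else 0)"

text \<open>The \<open>h\<^sup>2\<close> zeros at either end permit \<open>h\<^sup>2\<close>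
  removals of a pair; the surplus \<open>l\<close> adjusts the length.\<close>

definition hard_string :: "(nat \<Rightarrow> bool) \<Rightarrow> nat \<Rightarrow> nat \<Rightarrow> real list" where
  "hard_string P h l = replicate (h\<^sup>2) 0 @
     map (\<lambda>i. parity_weight P h i / (1 + parity_weight P h i)) [0..<2 * h\<^sup>2] @ replicate (h\<^sup>2 + l) 0"

lemma parity_weight_nonneg: "0 \<le> parity_weight P h i"
  using amplitude_pos by (simp add: parity_weight_def gauss_weight_nonneg)

lemma finite_set_trace_dist: "finite (set_pmf (trace_dist S d))"
  by (simp add: trace_dist_def finite_set_sample_bits finite_set_deletion_channel)

lemma expect_trace_dist_padded:
  "expect (trace_dist (replicate q 0 @ S @ replicate l 0) d) g = expect (sample_bits S)
     (\<lambda>t. expect (deletion_channel d (replicate q False @ t @ replicate l False)) g)"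
  by (simp add: trace_dist_def expect_bind_finite finite_set_sample_bits finite_set_deletion_channel
      sample_bits_append sample_bits_replicate_0 bind_return_pmf map_pmf_def bind_assoc_pmf)

text \<open>The normalizing constant stays on the left so that the sums for the two parities can be
  subtracted termwise.\<close>

lemma expect_hard_string:
  "(\<Prod>i<2 * h\<^sup>2. 1 + parity_weight P h i) * expect (trace_dist (hard_string P h l) d) g =
    (\<Sum>X\<in>Pow {..<2 * h\<^sup>2}. of_bool (\<forall>i\<in>X. P i) * (\<Prod>i\<in>X. gauss_weight amplitude h (real i)) *
       expect (deletion_channel d (replicate (h\<^sup>2) False @ indicator_word (2 * h\<^sup>2) X @ replicate (h\<^sup>2 + l) False)) g)"
proof -
  have "(\<Prod>i\<in>X. parity_weight P h i) = of_bool (\<forall>i\<in>X. P i) * (\<Prod>i\<in>X. gauss_weight amplitude h (real i))"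
    if "X \<in> Pow {..<2 * h\<^sup>2}" for X
  proof (cases "\<forall>i\<in>X. P i")
    case False
    moreover have "finite X" using that by (auto intro: finite_subset)
    ultimately have "(\<Prod>i\<in>X. parity_weight P h i) = 0"
      by (auto simp: parity_weight_def)
    then show ?thesis using False by simp
  qed (simp add: parity_weight_def)
  then show ?thesis
    unfolding hard_string_def expect_trace_dist_padded expect_sample_bits_odds[OF parity_weight_nonneg]
    by (intro sum.cong) auto
qed

lemma abs_diff_expect_hard_string_le:
  assumes h: "32 \<le> h" and g: "\<And>t. \<bar>g t\<bar> \<le> 1"
  shows "\<bar>expect (trace_dist (hard_string odd h l) (8 / real h)) g
    - expect (trace_dist (hard_string even h l) (8 / real h)) g\<bar> \<le> exp (- real h / 2)"
proof -
  define Z where "Z = (\<lambda>P. \<Prod>i<2 * h\<^sup>2. 1 + parity_weight P h i)"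
  define E where "E = (\<lambda>P g. expect (trace_dist (hard_string P h l) (8 / real h)) g)"
  have diff: "\<bar>Z odd * E odd f - Z even * E even f\<bar> \<le> 2 * exp (- real h)" if "\<And>t. \<bar>f t\<bar> \<le> 1" for f
  proof -
    have "Z odd * E odd f - Z even * E even f = padded_expect amplitude h (8 / real h) f 0 0 (h\<^sup>2) (h\<^sup>2 + l)"
      unfolding Z_def E_def expect_hard_string padded_expect_def signed_weight_def parity_sign_def
        sum_subtractf[symmetric]
      by (intro sum.cong refl) (simp add: left_diff_distrib)
    then show ?thesis using padded_expect_amplitude_le[OF h that] by simp
  qed
  \<comment> \<open>The constant test function shows that the two normalizing constants nearly
    agree.\<close>
  have "\<bar>Z odd - Z even\<bar> \<le> 2 * exp (- real h)"
    using diff[of "\<lambda>_. 1"] by (simp add: E_def)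
  moreover have "\<bar>E even g\<bar> \<le> 1" unfolding E_def by (rule expect_abs_le[OF g])
  ultimately have "\<bar>(Z even - Z odd) * E even g\<bar> \<le> 2 * exp (- real h) * 1"
    unfolding abs_mult by (intro mult_mono) auto
  moreover have "Z odd * (E odd g - E even g)
      = (Z odd * E odd g - Z even * E even g) + (Z even - Z odd) * E even g"
    by (simp add: algebra_simps)
  ultimately have b: "\<bar>Z odd * (E odd g - E even g)\<bar> \<le> 4 * exp (- real h)"
    using diff[of g, OF g] by linarith
  have "Z odd \<ge> 1"
    unfolding Z_def by (intro prod_ge_1) (simp add: parity_weight_nonneg)
  then have "1 * \<bar>E odd g - E even g\<bar> \<le> Z odd * \<bar>E odd g - E even g\<bar>"
    by (intro mult_right_mono) auto
  also have "\<dots> \<le> 4 * exp (- real h)" using b \<open>Z odd \<ge> 1\<close> by (simp add: abs_mult)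
  \<comment> \<open>Half of the exponent is given up to absorb the constant 4.\<close>
  also have "\<dots> \<le> exp (real h / 2) * exp (- real h)"
  proof (rule mult_right_mono)
    show "4 \<le> exp (real h / 2)" using exp_ge_add_one_self[of "real h / 2"] h by linarith
  qed simp
  also have "\<dots> = exp (- real h / 2)" by (simp add: exp_add[symmetric])
  finally show ?thesis by (simp add: E_def)
qed

text \<open>The second rate solves \<open>d + (1 - d) * e = \<delta>\<close>. An event after both
  passes becomes a test function with values in \<open>[0, 1]\<close> after the first, which is why
  the earlier bounds allow general \<open>g\<close>.\<close>

lemma prob_trace_dist_compose:
  assumes "0 \<le> d" "d < 1" "d \<le> \<delta>" "\<delta> < 1"
  shows "measure_pmf.prob (trace_dist S \<delta>) A =
    expect (trace_dist S d) (\<lambda>t. measure_pmf.prob (deletion_channel ((\<delta> - d) / (1 - d)) t) A)"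
proof -
  define e where "e = (\<delta> - d) / (1 - d)"
  have e: "0 \<le> e" "e \<le> 1" using assms by (auto simp: e_def field_simps)
  have \<delta>: "d + (1 - d) * e = \<delta>" using assms by (simp add: e_def)
  have "trace_dist S \<delta> = bind_pmf (trace_dist S d) (deletion_channel e)"
    using assms e by (simp add: trace_dist_def bind_assoc_pmf deletion_channel_compose \<delta>)
  moreover have "measure_pmf.prob p A = expect p (indicator A)" for p :: "bool list pmf"
    by simp
  ultimately show ?thesis
    by (simp only: expect_bind_finite[OF finite_set_trace_dist finite_set_deletion_channel] e_def)
qed

lemma tv_dist_hard_string_le:
  assumes h: "32 \<le> h" and \<delta>: "8 / real h \<le> \<delta>" "\<delta> < 1"
  shows "tv_dist (trace_dist (hard_string odd h l) \<delta>) (trace_dist (hard_string even h l) \<delta>) \<le> exp (- real h / 2)"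
  unfolding tv_dist_def
proof (rule cSUP_least)
  fix A
  have "0 \<le> 8 / real h" "8 / real h < 1" using h by auto
  note prob = prob_trace_dist_compose[OF this \<delta>]
  show "\<bar>measure_pmf.prob (trace_dist (hard_string odd h l) \<delta>) A
     - measure_pmf.prob (trace_dist (hard_string even h l) \<delta>) A\<bar> \<le> exp (- real h / 2)"
    unfolding prob by (rule abs_diff_expect_hard_string_le[OF h]) simp
qed simp

section \<open>Entrywise differences of the two strings\<close>

lemma length_hard_string: "length (hard_string P h l) = 4 * h\<^sup>2 + l"
  by (simp add: hard_string_def)

lemma nth_hard_string:
  assumes "i < 4 * h\<^sup>2 + l"
  shows "hard_string P h l ! i = (if h\<^sup>2 \<le> i \<and> i < h\<^sup>2 + 2 * h\<^sup>2
    then parity_weight P h (i - h\<^sup>2) / (1 + parity_weight P h (i - h\<^sup>2)) else 0)"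
  using assms by (auto simp: hard_string_def nth_append)

lemma nth_hard_string_bounds:
  assumes "i < 4 * h\<^sup>2 + l"
  shows "0 \<le> hard_string P h l ! i" "hard_string P h l ! i \<le> 1"
proof -
  have b: "0 \<le> x / (1 + x)" "x / (1 + x) \<le> 1" if "0 \<le> x" for x :: real
    using that by auto
  then show "0 \<le> hard_string P h l ! i" "hard_string P h l ! i \<le> 1"
    unfolding nth_hard_string[OF assms] using b[OF parity_weight_nonneg[of P h "i - h\<^sup>2"]] by simp_all
qed

text \<open>At each window position parity makes exactly one of the two entries nonzero, so that
  entry is the whole gap.\<close>

definition weight_gap :: "nat \<Rightarrow> nat \<Rightarrow> real" where
  "weight_gap h i = gauss_weight amplitude h (real i) / (1 + gauss_weight amplitude h (real i))"

lemma abs_diff_hard_string: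
  assumes "i < 4 * h\<^sup>2 + l"
  shows "\<bar>hard_string odd h l ! i - hard_string even h l ! i\<bar> =
    (if h\<^sup>2 \<le> i \<and> i < h\<^sup>2 + 2 * h\<^sup>2 then weight_gap h (i - h\<^sup>2) else 0)"
proof -
  have "0 \<le> gauss_weight amplitude h x" for x
    using amplitude_pos by (simp add: gauss_weight_nonneg)
  then show ?thesis
    unfolding nth_hard_string[OF assms] by (simp add: parity_weight_def weight_gap_def)
qed

lemma sum_abs_diff_hard_string:
  "(\<Sum>i<4 * h\<^sup>2 + l. \<bar>hard_string odd h l ! i - hard_string even h l ! i\<bar>) = (\<Sum>i<2 * h\<^sup>2. weight_gap h i)"
proof -
  have "(\<Sum>i<4 * h\<^sup>2 + l. \<bar>hard_string odd h l ! i - hard_string even h l ! i\<bar>)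
     = (\<Sum>i<4 * h\<^sup>2 + l. if h\<^sup>2 \<le> i \<and> i < h\<^sup>2 + 2 * h\<^sup>2 then weight_gap h (i - h\<^sup>2) else 0)"
    by (intro sum.cong refl abs_diff_hard_string) simp
  also have "\<dots> = (\<Sum>i\<in>{0 + h\<^sup>2..<2 * h\<^sup>2 + h\<^sup>2}. weight_gap h (i - h\<^sup>2))"
    by (subst sum.If_cases) (auto intro!: sum.cong)
  also have "\<dots> = (\<Sum>i<2 * h\<^sup>2. weight_gap h i)"
    by (subst sum.shift_bounds_nat_ivl) (simp add: atLeast0LessThan)
  finally show ?thesis .
qed

text \<open>The weight lies in \<open>[0, 1]\<close>, so the denominator lies between 1 and
  2.\<close>

lemma weight_gap_bounds:
  "gauss_weight amplitude h (real i) / 2 \<le> weight_gap h i" "weight_gap h i \<le> gauss_weight amplitude h (real i)"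
proof -
  define x where "x = gauss_weight amplitude h (real i)"
  have "amplitude * exp (- (scaled_dist h i)\<^sup>2) \<le> 1 * 1"
    using amplitude_le amplitude_pos by (intro mult_mono) auto
  then have "0 \<le> x" "x \<le> 1"
    using amplitude_pos by (simp_all add: x_def gauss_weight_nonneg gauss_weight_nat)
  then have "x / 2 \<le> x / (1 + x)" "x / (1 + x) \<le> x / 1"
    by (intro divide_left_mono; simp)+
  then show "gauss_weight amplitude h (real i) / 2 \<le> weight_gap h i" "weight_gap h i \<le> gauss_weight amplitude h (real i)"
    by (simp_all add: weight_gap_def x_def)
qed

lemma sum_weight_gap_le:
  assumes "h > 0"
  shows "(\<Sum>i<m. weight_gap h i) \<le> real h"
  using sum_mono[of "{..<m}", OF weight_gap_bounds(2)] sum_gauss_weight_le[OF assms, of m]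
  by (rule order_trans)

lemma sum_weight_gap_ge:
  assumes h: "h > 0"
  shows "amplitude * exp (- 1) / 2 * real h \<le> (\<Sum>i<2 * h\<^sup>2. weight_gap h i)"
proof -
  \<comment> \<open>These \<open>h\<close> positions lie within one width of the centre and already
    give a sum of order \<open>h\<close>.\<close>
  have "amplitude * exp (- 1) / 2 \<le> weight_gap h i" if i: "i \<in> {h\<^sup>2..<h\<^sup>2 + h}" for i
  proof -
    have "real (h\<^sup>2) \<le> real i" "real i \<le> real (h\<^sup>2 + h)"
      using i unfolding of_nat_le_iff by auto
    then have "scaled_dist h i \<le> 1" using h by (simp add: scaled_dist_def)
    then have "(scaled_dist h i)\<^sup>2 \<le> 1" by (simp add: power_le_one)
    then have "amplitude * exp (- 1) \<le> gauss_weight amplitude h (real i)"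
      using amplitude_pos by (simp add: gauss_weight_nat)
    then show ?thesis using weight_gap_bounds(1)[of h i] by linarith
  qed
  then have "real (card {h\<^sup>2..<h\<^sup>2 + h}) * (amplitude * exp (- 1) / 2) \<le> (\<Sum>i\<in>{h\<^sup>2..<h\<^sup>2 + h}. weight_gap h i)"
    by (intro sum_bounded_below)
  also have "\<dots> \<le> (\<Sum>i<2 * h\<^sup>2. weight_gap h i)"
  proof (rule sum_mono2)
    have "h \<le> h\<^sup>2" by (simp add: power2_nat_le_imp_le power2_eq_square)
    then show "{h\<^sup>2..<h\<^sup>2 + h} \<subseteq> {..<2 * h\<^sup>2}" by auto
    show "0 \<le> weight_gap h i" for i
      using amplitude_pos by (simp add: weight_gap_def gauss_weight_nonneg add_nonneg_nonneg)
  qed simp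
  finally show ?thesis by (simp add: mult.commute)
qed

text \<open>As \<open>4356\<close> is the square of 66, \<open>sqrt n / 2\<close> is at least 33,
  and rounding down stays above the threshold 32.\<close>

lemma exists_half_sqrt:
  assumes "4356 \<le> n"
  obtains h :: nat where "32 \<le> h" "4 * h\<^sup>2 \<le> n" "2 * real h \<le> sqrt (real n)" "sqrt (real n) \<le> 4 * real h"
proof
  define h where "h = nat \<lfloor>sqrt (real n) / 2\<rfloor>"
  have "sqrt 4356 = (66::real)" by (rule real_sqrt_unique) auto
  then have "66 \<le> sqrt (real n)" using assms by (metis of_nat_le_iff of_nat_numeral real_sqrt_le_iff)
  moreover have h: "real h \<le> sqrt (real n) / 2" "sqrt (real n) / 2 < real h + 1"
    unfolding h_def using of_int_floor_le[of "sqrt (real n) / 2"] real_of_int_floor_add_one_gt[of "sqrt (real n) / 2"]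
    by (simp_all add: of_nat_nat)
  ultimately show "32 \<le> h" "2 * real h \<le> sqrt (real n)" "sqrt (real n) \<le> 4 * real h"
    by linarith+
  have "(2 * real h)\<^sup>2 \<le> (sqrt (real n))\<^sup>2" using h by (intro power_mono) auto
  then have "real (4 * h\<^sup>2) \<le> real n" by (simp add: power_mult_distrib)
  then show "4 * h\<^sup>2 \<le> n" by (simp only: of_nat_le_iff)
qed

theorem theorem1:
  shows "\<exists>c>0. \<exists>\<epsilon>>0. \<exists>A>0. \<exists>B>0. \<exists>C>0. \<exists>N::nat. \<forall>n\<ge>N.
     \<exists>S S' :: real list.
       length S = n \<and> length S' = n \<and>
       (\<forall>i<n. 0 \<le> S ! i \<and> S ! i \<le> 1 \<and> 0 \<le> S' ! i \<and> S' ! i \<le> 1) \<and>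
       (\<exists>i<n. \<bar>S ! i - S' ! i\<bar> \<ge> \<epsilon>) \<and>
       A * sqrt (real n) \<le> (\<Sum>i<n. \<bar>S ! i - S' ! i\<bar>) \<and>
       (\<Sum>i<n. \<bar>S ! i - S' ! i\<bar>) \<le> B * sqrt (real n) \<and>
       (\<forall>\<delta>::real. c / sqrt (real n) \<le> \<delta> \<and> \<delta> < 1 \<longrightarrow>
          tv_dist (trace_dist S \<delta>) (trace_dist S' \<delta>) \<le> exp (- C * sqrt (real n)))"
proof -
  \<comment> \<open>The constants come from \<open>2 * h \<le> sqrt n \<le> 4 * h\<close>: then
    \<open>8 / h \<le> 32 / sqrt n\<close> and \<open>h / 2 \<ge> sqrt n / 8\<close>, and the sum
    lies between \<open>amplitude * exp (- 1) / 2 * h\<close> and \<open>h\<close>.\<close>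
  have main: "\<exists>S S' :: real list.
       length S = n \<and> length S' = n \<and>
       (\<forall>i<n. 0 \<le> S ! i \<and> S ! i \<le> 1 \<and> 0 \<le> S' ! i \<and> S' ! i \<le> 1) \<and>
       (\<exists>i<n. \<bar>S ! i - S' ! i\<bar> \<ge> amplitude / 2) \<and>
       amplitude * exp (- 1) / 8 * sqrt (real n) \<le> (\<Sum>i<n. \<bar>S ! i - S' ! i\<bar>) \<and>
       (\<Sum>i<n. \<bar>S ! i - S' ! i\<bar>) \<le> 1 * sqrt (real n) \<and>
       (\<forall>\<delta>::real. 32 / sqrt (real n) \<le> \<delta> \<and> \<delta> < 1 \<longrightarrow>
          tv_dist (trace_dist S \<delta>) (trace_dist S' \<delta>) \<le> exp (- (1 / 8) * sqrt (real n)))"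
    if n: "4356 \<le> n" for n
  proof -
    obtain h where h: "32 \<le> h" "4 * h\<^sup>2 \<le> n" "2 * real h \<le> sqrt (real n)" "sqrt (real n) \<le> 4 * real h"
      using exists_half_sqrt[OF n] by blast
    have h0: "h > 0" using h by simp
    obtain l where l: "n = 4 * h\<^sup>2 + l" using h(2) le_Suc_ex by blast
    have peak: "\<exists>i<n. \<bar>hard_string odd h l ! i - hard_string even h l ! i\<bar> \<ge> amplitude / 2"
    proof (intro exI conjI)
      \<comment> \<open>The centre \<open>h\<^sup>2\<close> of the window sits at
        \<open>2 * h\<^sup>2\<close> in the string because of the left padding; the weight there is
        \<open>amplitude\<close>.\<close>
      show i: "2 * h\<^sup>2 < n" using l h0 by simp
      have "gauss_weight amplitude h (real (h\<^sup>2)) = amplitude" by (simp add: gauss_weight_def)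
      then have "amplitude / 2 \<le> weight_gap h (h\<^sup>2)" using weight_gap_bounds(1)[of h "h\<^sup>2"] by simp
      then show "\<bar>hard_string odd h l ! (2 * h\<^sup>2) - hard_string even h l ! (2 * h\<^sup>2)\<bar> \<ge> amplitude / 2"
        using i h0 unfolding l by (simp add: abs_diff_hard_string)
    qed
    have lower: "amplitude * exp (- 1) / 8 * sqrt (real n) \<le> (\<Sum>i<n. \<bar>hard_string odd h l ! i - hard_string even h l ! i\<bar>)"
    proof -
      have "amplitude * exp (- 1) / 8 * sqrt (real n) \<le> amplitude * exp (- 1) / 8 * (4 * real h)"
        using h(4) amplitude_pos by (intro mult_left_mono) auto
      also have "\<dots> \<le> (\<Sum>i<2 * h\<^sup>2. weight_gap h i)"
        using sum_weight_gap_ge[OF h0] by (simp add: mult_ac)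
      finally show ?thesis unfolding l sum_abs_diff_hard_string .
    qed
    have upper: "(\<Sum>i<n. \<bar>hard_string odd h l ! i - hard_string even h l ! i\<bar>) \<le> 1 * sqrt (real n)"
    proof -
      have "(\<Sum>i<2 * h\<^sup>2. weight_gap h i) \<le> 1 * sqrt (real n)"
        using sum_weight_gap_le[OF h0, of "2 * h\<^sup>2"] h(3) by simp
      then show ?thesis unfolding l sum_abs_diff_hard_string .
    qed
    have tv: "tv_dist (trace_dist (hard_string odd h l) \<delta>) (trace_dist (hard_string even h l) \<delta>)
        \<le> exp (- (1 / 8) * sqrt (real n))"
      if "32 / sqrt (real n) \<le> \<delta>" "\<delta> < 1" for \<delta>
    proof -
      have "8 / real h = 32 / (4 * real h)" by simp
      also have "\<dots> \<le> 32 / sqrt (real n)"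
        using h n by (intro divide_left_mono) auto
      finally have "8 / real h \<le> \<delta>" using that(1) by linarith
      then have "tv_dist (trace_dist (hard_string odd h l) \<delta>) (trace_dist (hard_string even h l) \<delta>) \<le> exp (- real h / 2)"
        by (rule tv_dist_hard_string_le[OF h(1) _ that(2)])
      also have "\<dots> \<le> exp (- (1 / 8) * sqrt (real n))" using h(4) by simp
      finally show ?thesis .
    qed
    show ?thesis
      using peak lower upper tv
      by (intro exI[of _ "hard_string odd h l"] exI[of _ "hard_string even h l"])
        (auto simp: l length_hard_string nth_hard_string_bounds)
  qed
  have pos: "amplitude / 2 > 0" "amplitude * exp (- 1) / 8 > 0" "(32::real) > 0" "(1::real) > 0" "(1 / 8 :: real) > 0"
    using amplitude_pos by auto
  show ?thesis
    using main pos by blast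
qed

end
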